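(* Let $\mathbf x$ be a closed soliton on the light-cone $LC^*$ in $\mathbb E^3_1$ for the third-order flow $\frac{\partial \mathbf r}{\partial t}=(k_g)_s\mathbf r-k_g\mathbf T$. Then one of the following holds: (1) $\mathbf x$ is a planar ellipse; (2) $\mathbf x=\mathbf x_{p,q}$ has rotation index $p$ and closes up in $q$ periods of its curvature function $k_g$, where $p,q$ are relatively prime positive integers, and the pair $(p,q)$ is not arbitrary but must satisfy $$\frac pq\in\left(\sqrt{2/3},\,1\right).$$
   Context: $\mathbb E^3_1$ is $\mathbb R^3$ with $\langle \mathbf u,\mathbf v\rangle_L=-u_1v_1+u_2v_2+u_3v_3$, and $LC^*=\{(\psi,\psi\cos\theta,\psi\sin\theta):\psi>0\}$. Curves on $LC^*$ are smooth with space-like (non-vanishing) velocity, $s$ is the arc length ($ds/dp=\sqrt{\langle \mathbf r_p,\mathbf r_p\rangle_L}$), $\mathbf T=\mathbf r_s$, $\mathbf Y$ is the unique light-like vector field along $\mathbf r$ with $\langle \mathbf Y,\mathbf T\rangle_L=0$, $\langle \mathbf r,\mathbf Y\rangle_L=1$, and $k_g=\langle \mathbf r_{ss},\mathbf Y\rangle_L$. Curves are oriented so that, writing $\mathbf r=(\psi,\psi\cos\theta,\psi\sin\theta)$ with $\theta$ a continuous angle, $d\theta/ds=1/\psi$. A soliton of the flow is a curve that keeps its shape under the flow, i.e. it moves by isometries (Lorentz transformations); for this flow the arc length element is preserved ($g_t=0$) and $(k_g)_t=(k_g)_{sss}-3k_g(k_g)_s$, so the soliton condition is $(k_g)_{sss}-3k_g(k_g)_s=0$.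 A soliton is closed if it is a closed curve, traversed once. The rotation index is $\frac{1}{2\pi}$ times the total increment of $\theta$ along the closed curve. "Closes up in $q$ periods" means that the total arc length is $q$ times the minimal period of the (non-constant) function $k_g(s)$. *)

theory Defs
  imports "HOL-Analysis.Analysis"
begin

definition smooth_curve :: "(real \<Rightarrow> 'a::real_normed_vector) \<Rightarrow> bool" where
  "smooth_curve f \<longleftrightarrow>
     (\<forall>n s. ((\<lambda>g t. vector_derivative g (at t)) ^^ n) f differentiable (at s))"

definition lorentz_inner :: "real^3 \<Rightarrow> real^3 \<Rightarrow> real" (infixl "\<bullet>\<^sub>L" 70) where
  "u \<bullet>\<^sub>L v = - (u$1 * v$1) + u$2 * v$2 + u$3 * v$3"

definition light_like :: "real^3 \<Rightarrow> bool" where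
  "light_like u \<longleftrightarrow> u \<noteq> 0 \<and> u \<bullet>\<^sub>L u = 0"

definition light_cone :: "(real^3) set" where
  "light_cone = {vector [\<psi>, \<psi> * cos \<theta>, \<psi> * sin \<theta>] |\<psi> \<theta>. \<psi> > 0}"

definition lorentz_transformation :: "(real^3 \<Rightarrow> real^3) \<Rightarrow> bool" where
  "lorentz_transformation A \<longleftrightarrow> linear A \<and> (\<forall>u v. A u \<bullet>\<^sub>L A v = u \<bullet>\<^sub>L v)"

definition angle_function :: "(real \<Rightarrow> real^3) \<Rightarrow> (real \<Rightarrow> real) \<Rightarrow> bool" where
  "angle_function r \<theta> \<longleftrightarrow> continuous_on UNIV \<theta> \<and>
     (\<forall>s. r s = vector [r s $ 1, r s $ 1 * cos (\<theta> s), r s $ 1 * sin (\<theta> s)])"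

definition tangent :: "(real \<Rightarrow> real^3) \<Rightarrow> real \<Rightarrow> real^3" where
  "tangent r s = vector_derivative r (at s)"

text \<open>Curves are represented by their arc length parametrization, so that the parameter is
  \<open>s\<close>; the unit speed condition makes the velocity space-like and non-vanishing.
  The last conjunct fixes the orientation, \<open>d\<theta>/ds = 1/\<psi>\<close>.\<close>
definition light_cone_curve :: "(real \<Rightarrow> real^3) \<Rightarrow> bool" where
  "light_cone_curve r \<longleftrightarrow> smooth_curve r \<and> (\<forall>s. r s \<in> light_cone) \<and>
     (\<forall>s. tangent r s \<bullet>\<^sub>L tangent r s = 1) \<and>
     (\<exists>\<theta>. angle_function r \<theta> \<and> (\<forall>s. (\<theta> has_real_derivative 1 / (r s $ 1)) (at s)))"

definition Y_field :: "(real \<Rightarrow> real^3) \<Rightarrow> real \<Rightarrow> real^3" where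
  "Y_field r s = (THE y. light_like y \<and> y \<bullet>\<^sub>L tangent r s = 0 \<and> r s \<bullet>\<^sub>L y = 1)"

definition geodesic_curvature :: "(real \<Rightarrow> real^3) \<Rightarrow> real \<Rightarrow> real" where
  "geodesic_curvature r s = vector_derivative (tangent r) (at s) \<bullet>\<^sub>L Y_field r s"

text \<open>\<open>R t\<close> is the curve at time \<open>t\<close>. The flow preserves the arc length element, so
  \<open>s\<close> stays the arc length parameter at all times.\<close>
definition third_order_flow :: "real set \<Rightarrow> (real \<Rightarrow> real \<Rightarrow> real^3) \<Rightarrow> bool" where
  "third_order_flow I R \<longleftrightarrow> (\<forall>t\<in>I. light_cone_curve (R t) \<and>
     (\<forall>s. ((\<lambda>\<tau>. R \<tau> s) has_vector_derivative
        deriv (geodesic_curvature (R t)) s *\<^sub>R R t s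
          - geodesic_curvature (R t) s *\<^sub>R tangent (R t) s) (at t)))"

text \<open>The motion is by isometries of the parametrized curve, without a shift of \<open>s\<close>.
  Then \<open>k\<^sub>g\<close> does not depend on \<open>t\<close>, which is the condition
  \<open>k\<^sub>s\<^sub>s\<^sub>s - 3 k k\<^sub>s = 0\<close> for \<open>k = k\<^sub>g\<close>. A shift would give
  \<open>k\<^sub>s\<^sub>s\<^sub>s - 3 k k\<^sub>s = c k\<^sub>s\<close>.\<close>
definition soliton :: "(real \<Rightarrow> real^3) \<Rightarrow> bool" where
  "soliton r \<longleftrightarrow> light_cone_curve r \<and>
     (\<exists>\<epsilon>>0. \<exists>A. (\<forall>t\<in>{-\<epsilon><..<\<epsilon>}. lorentz_transformation (A t)) \<and> A 0 = id \<and>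
        third_order_flow {-\<epsilon><..<\<epsilon>} (\<lambda>t s. A t (r s)))"

text \<open>A constant function has no minimal period.\<close>
definition minimal_period :: "(real \<Rightarrow> 'a) \<Rightarrow> real \<Rightarrow> bool" where
  "minimal_period f P \<longleftrightarrow> P > 0 \<and> (\<forall>s. f (s + P) = f s) \<and>
     (\<forall>Q. 0 < Q \<and> Q < P \<longrightarrow> (\<exists>s. f (s + Q) \<noteq> f s))"

text \<open>Closed, of total arc length \<open>L\<close>; minimality of \<open>L\<close> says that the curve is
  traversed once. Self-intersections are allowed.\<close>
definition closed_curve :: "(real \<Rightarrow> real^3) \<Rightarrow> real \<Rightarrow> bool" where
  "closed_curve r L \<longleftrightarrow> minimal_period r L"

text \<open>Two angle functions of a curve differ by a constant, so the choice is immaterial.\<close>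
definition rotation_index :: "(real \<Rightarrow> real^3) \<Rightarrow> real \<Rightarrow> real" where
  "rotation_index r L =
     (let \<theta> = (SOME \<theta>. angle_function r \<theta>) in (\<theta> L - \<theta> 0) / (2 * pi))"

definition ellipse :: "(real^3) set \<Rightarrow> bool" where
  "ellipse E \<longleftrightarrow> (\<exists>c u v a b. norm u = 1 \<and> norm v = 1 \<and> u \<bullet> v = 0 \<and> a > 0 \<and> b > 0 \<and>
     E = {c + (a * cos \<phi>) *\<^sub>R u + (b * sin \<phi>) *\<^sub>R v |\<phi>. True})"

definition planar_ellipse :: "(real \<Rightarrow> real^3) \<Rightarrow> real \<Rightarrow> bool" where
  "planar_ellipse r L \<longleftrightarrow> (\<exists>E. ellipse E \<and> bij_betw r {0..<L} E)"

end

theory Submission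
  imports Defs
begin

text \<open>
  Let \<open>k\<close> be the geodesic curvature and \<open>N = r''\<close>, so that \<open>r''' = 2 k r' + k' r\<close>. The initial
  velocity \<open>k' r - k r'\<close> of an isometric motion is skew along the curve, and this gives
  \<open>k''' = 3 k k'\<close>. Hence \<open>k\<close> solves the same linear equation as the coordinates of \<open>r\<close>, that is,
  \<open>k\<close> is the inner product of \<open>r\<close> with a fixed vector, the pole. If \<open>k\<close> is constant, the curve is
  an ellipse. Otherwise, since \<open>N - 3/2 k r\<close> is periodic with derivative
  \<open>(k r' - k' r) / 2\<close>, half a Lorentzian cross product of the pole with \<open>r\<close>, the pole is parallel
  to the integral of \<open>r\<close> over a period and therefore time-like. So \<open>\<kappa> = - k\<close> is positive and
  oscillates between roots \<open>\<alpha> < \<beta>\<close> of the cubic in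
  \<open>(\<kappa>')\<^sup>2 = (\<kappa> - \<alpha>) (\<beta> - \<kappa>) (\<kappa> + \<alpha> + \<beta>)\<close>, and the curve rotates about the pole with
  angular speed \<open>sqrt (\<alpha> \<beta> (\<alpha> + \<beta>)) / \<kappa>\<close>. The rotation \<open>\<Theta>\<close> during one period of \<open>\<kappa>\<close> lies
  strictly between \<open>2 \<pi> sqrt (2/3)\<close> and \<open>2 \<pi>\<close>, and closing up after \<open>q\<close> periods means
  \<open>q \<Theta> = 2 \<pi> p\<close>. The number \<open>p\<close> is the rotation index because both angles count the returns of
  the curve to the null line through its starting point.
\<close>

section \<open>Periodic functions and angles\<close>

lemma antiderivative_exists_UNIV:
  fixes f :: "real \<Rightarrow> 'a::euclidean_space"
  assumes "continuous_on UNIV f"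
  shows "\<exists>F. \<forall>s. (F has_vector_derivative f s) (at s)"
proof -
  have "\<exists>F. \<forall>s. -\<infinity> < ereal s \<longrightarrow> ereal s < \<infinity> \<longrightarrow> (F has_vector_derivative f s) (at s)"
    by (rule einterval_antiderivative) (use assms continuous_on_eq_continuous_at[OF open_UNIV] in auto)
  then show ?thesis by simp
qed

lemma real_antiderivative_exists_UNIV:
  fixes f :: "real \<Rightarrow> real"
  assumes "continuous_on UNIV f"
  shows "\<exists>F. \<forall>s. (F has_real_derivative f s) (at s)"
  using antiderivative_exists_UNIV[OF assms]
  unfolding has_real_derivative_iff_has_vector_derivative .

lemma differentiable_imp_continuous_on_UNIV:
  fixes f :: "real \<Rightarrow> real"
  assumes "\<And>s. (f has_real_derivative f' s) (at s)"
  shows "continuous_on UNIV f"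
  by (intro continuous_at_imp_continuous_on ballI DERIV_isCont[OF assms])

lemma vector_derivative_zero_imp_const:
  fixes f :: "real \<Rightarrow> 'a::real_normed_vector"
  assumes "\<And>s. (f has_vector_derivative 0) (at s)"
  shows "f s = f t"
proof -
  obtain c where "\<And>x. x \<in> UNIV \<Longrightarrow> f x = c"
    using has_vector_derivative_zero_constant[of UNIV f] assms by auto
  then show ?thesis by simp
qed

text \<open>Turning the pair \<open>(u, v)\<close> back by the angle
  \<open>\<phi> s - \<phi> t\<close> gives a pair with zero derivative. At \<open>t\<close> this
  pair is \<open>(u t, v t)\<close>, and undoing the turn gives both formulas.\<close>

lemma rotating_frame:
  fixes u v :: "real \<Rightarrow> 'a::real_normed_vector"
  assumes u: "\<And>s. (u has_vector_derivative w s *\<^sub>R v s) (at s)"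
    and v: "\<And>s. (v has_vector_derivative - w s *\<^sub>R u s) (at s)"
    and \<phi>: "\<And>s. (\<phi> has_real_derivative w s) (at s)"
  shows "u s = cos (\<phi> s - \<phi> t) *\<^sub>R u t + sin (\<phi> s - \<phi> t) *\<^sub>R v t"
    and "v s = cos (\<phi> s - \<phi> t) *\<^sub>R v t - sin (\<phi> s - \<phi> t) *\<^sub>R u t"
proof -
  define C where "C = (\<lambda>s. cos (\<phi> s - \<phi> t))"
  define S where "S = (\<lambda>s. sin (\<phi> s - \<phi> t))"
  have C: "(C has_real_derivative - S s * w s) (at s)" for s
    unfolding C_def S_def by (auto intro!: derivative_eq_intros \<phi>)
  have S: "(S has_real_derivative C s * w s) (at s)" for s
    unfolding C_def S_def by (auto intro!: derivative_eq_intros \<phi>)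
  have "((\<lambda>s. C s *\<^sub>R u s - S s *\<^sub>R v s) has_vector_derivative 0) (at s)" for s
    by (auto intro!: derivative_eq_intros C S u v simp: algebra_simps)
  from vector_derivative_zero_imp_const[OF this, of s t]
  have 1: "C s *\<^sub>R u s - S s *\<^sub>R v s = u t" by (simp add: C_def S_def)
  have "((\<lambda>s. S s *\<^sub>R u s + C s *\<^sub>R v s) has_vector_derivative 0) (at s)" for s
    by (auto intro!: derivative_eq_intros C S u v simp: algebra_simps)
  from vector_derivative_zero_imp_const[OF this, of s t]
  have 2: "S s *\<^sub>R u s + C s *\<^sub>R v s = v t" by (simp add: C_def S_def)
  have 3: "C s * C s + S s * S s = 1"
    by (simp add: C_def S_def flip: power2_eq_square)
  have "C s *\<^sub>R u t + S s *\<^sub>R v t = (C s * C s + S s * S s) *\<^sub>R u s"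
    by (simp add: 1[symmetric] 2[symmetric] algebra_simps)
  then show "u s = cos (\<phi> s - \<phi> t) *\<^sub>R u t + sin (\<phi> s - \<phi> t) *\<^sub>R v t"
    unfolding 3 by (simp add: C_def S_def)
  have "C s *\<^sub>R v t - S s *\<^sub>R u t = (C s * C s + S s * S s) *\<^sub>R v s"
    by (simp add: 1[symmetric] 2[symmetric] algebra_simps)
  then show "v s = cos (\<phi> s - \<phi> t) *\<^sub>R v t - sin (\<phi> s - \<phi> t) *\<^sub>R u t"
    unfolding 3 by (simp add: C_def S_def)
qed

section \<open>Full turns and angle functions\<close>

lemma cos_eq_1_iff_int: "cos (y::real) = 1 \<longleftrightarrow> (\<exists>j::int. y = 2 * pi * j)"
  using cos_one_2pi_int[of y] by (simp add: mult.commute mult.left_commute)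

lemma cos_sin_turns: "cos (2 * pi * real n) = 1" "sin (2 * pi * real n) = 0"
  using cos_int_2pin[of "int n"] sin_int_2pin[of "int n"] by simp_all

lemma pos_deriv_strict_mono:
  fixes f :: "real \<Rightarrow> real"
  assumes "\<And>s. (f has_real_derivative f' s) (at s)" "\<And>s. f' s > 0"
  shows "strict_mono f"
proof (rule strict_monoI)
  fix a b :: real assume "a < b"
  then show "f a < f b"
    using assms by (intro DERIV_pos_imp_increasing[of a b f]) auto
qed

text \<open>The set of returns alone determines the number of turns, so two increasing angles with
  the same returns turn equally often. The interval is half-open because the return at
  \<open>L\<close> repeats the one at 0.\<close>

lemma card_full_turns:
  fixes \<phi> :: "real \<Rightarrow> real"
  assumes mono: "strict_mono \<phi>" and cont: "continuous_on UNIV \<phi>"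
    and L: "L > 0" and turn: "\<phi> L - \<phi> 0 = 2 * pi * real p"
  shows "card {s\<in>{0..<L}. cos (\<phi> s - \<phi> 0) = 1} = p"
proof -
  define Z where "Z = {s\<in>{0..<L}. cos (\<phi> s - \<phi> 0) = 1}"
  define f where "f = (\<lambda>s. (\<phi> s - \<phi> 0) / (2 * pi))"
  have fi: "inj_on f Z"
    using strict_mono_eq[OF mono] by (auto simp: inj_on_def f_def)
  have "f ` Z = real ` {..<p}"
  proof (intro set_eqI iffI)
    fix y assume "y \<in> f ` Z"
    then obtain s j where s: "0 \<le> s" "s < L" "y = f s" "\<phi> s - \<phi> 0 = 2 * pi * of_int j"
      by (auto simp: Z_def cos_eq_1_iff_int)
    have "\<phi> 0 \<le> \<phi> s" "\<phi> s < \<phi> L"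
      using s mono by (auto simp: strict_mono_less strict_mono_less_eq)
    then have "0 \<le> 2 * pi * of_int j" "2 * pi * of_int j < 2 * pi * real p"
      using s(4) turn by linarith+
    then have "0 \<le> j" "j < int p"
      using pi_gt_zero by (auto simp: zero_le_mult_iff mult_less_cancel_left_pos mult.assoc)
    moreover have "y = of_int j" using s by (simp add: f_def)
    ultimately have "y = real (nat j)" "nat j < p" by auto
    then show "y \<in> real ` {..<p}" by blast
  next
    fix y assume "y \<in> real ` {..<p}"
    then obtain j where j: "j < p" "y = real j" by auto
    have "2 * pi * real j \<le> 2 * pi * real p" "0 \<le> 2 * pi * real j"
      using j by auto
    then have "\<phi> 0 \<le> \<phi> 0 + 2 * pi * real j" "\<phi> 0 + 2 * pi * real j \<le> \<phi> L"
      using turn by linarith+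
    then obtain s where s: "0 \<le> s" "s \<le> L" "\<phi> s = \<phi> 0 + 2 * pi * real j"
      using IVT'[of \<phi> 0 "\<phi> 0 + 2 * pi * real j" L] L cont
      by (auto intro: continuous_on_subset)
    have "s \<noteq> L" using s j turn by auto
    with s have "s \<in> Z"
      by (auto simp: Z_def cos_eq_1_iff_int intro!: exI[of _ "int j"])
    moreover have "f s = y" using s j by (simp add: f_def)
    ultimately show "y \<in> f ` Z" by blast
  qed
  then have "card Z = card (real ` {..<p})"
    using card_image[OF fi] by simp
  also have "\<dots> = p" by (subst card_image) (auto simp: inj_on_def)
  finally show ?thesis by (simp add: Z_def)
qed

lemma angle_function_nth:
  assumes "angle_function r \<theta>"
  shows "r s $ 2 = r s $ 1 * cos (\<theta> s)" "r s $ 3 = r s $ 1 * sin (\<theta> s)"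
proof -
  have "r s = vector [r s $ 1, r s $ 1 * cos (\<theta> s), r s $ 1 * sin (\<theta> s)]"
    using assms unfolding angle_function_def by blast
  from arg_cong[OF this, of "\<lambda>v. v $ 2"] arg_cong[OF this, of "\<lambda>v. v $ 3"]
  show "r s $ 2 = r s $ 1 * cos (\<theta> s)" "r s $ 3 = r s $ 1 * sin (\<theta> s)"
    by simp_all
qed

text \<open>Both angles have the same cosine and sine because \<open>r s $ 1\<close> is positive.
  Their difference is thus a continuous function with values in the discrete set of multiples of
  \<open>2 * pi\<close>.\<close>

lemma angle_functions_differ_by_const:
  assumes "angle_function r \<theta>" "angle_function r \<eta>" "\<And>s. r s $ 1 > 0"
  shows "\<theta> s - \<theta> t = \<eta> s - \<eta> t"
proof -
  have cont: "continuous_on UNIV (\<lambda>s. \<theta> s - \<eta> s)"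
    using assms(1,2) unfolding angle_function_def by (auto intro!: continuous_intros)
  have int: "\<exists>j::int. \<theta> s - \<eta> s = 2 * pi * j" for s
  proof -
    have "cos (\<theta> s) = cos (\<eta> s)" "sin (\<theta> s) = sin (\<eta> s)"
      using angle_function_nth[OF assms(1), of s] angle_function_nth[OF assms(2), of s] assms(3)[of s]
      by auto
    then have "cos (\<theta> s - \<eta> s) = 1"
      by (simp add: cos_diff flip: power2_eq_square)
    then show ?thesis by (simp add: cos_eq_1_iff_int)
  qed
  have "(\<lambda>s. \<theta> s - \<eta> s) constant_on UNIV"
  proof (rule continuous_discrete_range_constant[OF _ cont])
    fix u :: real
    show "\<exists>e>0. \<forall>y. y \<in> UNIV \<and> \<theta> y - \<eta> y \<noteq> \<theta> u - \<eta> u \<longrightarrow> e \<le> norm (\<theta> y - \<eta> y - (\<theta> u - \<eta> u))"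
    proof (intro exI[of _ "2 * pi"] conjI allI impI)
      fix y assume y: "y \<in> UNIV \<and> \<theta> y - \<eta> y \<noteq> \<theta> u - \<eta> u"
      obtain i j :: int where ij: "\<theta> y - \<eta> y = 2 * pi * i" "\<theta> u - \<eta> u = 2 * pi * j"
        using int by meson
      then have "1 \<le> \<bar>i - j\<bar>" using y by auto
      then have "1 \<le> \<bar>real_of_int i - real_of_int j\<bar>" by linarith
      then have "2 * pi * 1 \<le> 2 * pi * \<bar>real_of_int i - real_of_int j\<bar>"
        by (intro mult_left_mono) auto
      also have "\<dots> = norm (\<theta> y - \<eta> y - (\<theta> u - \<eta> u))"
        unfolding ij by (simp add: abs_mult flip: right_diff_distrib)
      finally show "2 * pi \<le> norm (\<theta> y - \<eta> y - (\<theta> u - \<eta> u))" by simp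
    qed simp
  qed simp
  then obtain c where "\<theta> s - \<eta> s = c" for s
    by (auto simp: constant_on_def)
  from this[of s] this[of t] show ?thesis by linarith
qed

section \<open>Periodic functions on the line\<close>

lemma has_vector_derivative_shift:
  assumes "(f has_vector_derivative d) (at (s + L))"
  shows "((\<lambda>s. f (s + L)) has_vector_derivative d) (at s)"
proof -
  have "((\<lambda>s. s + L) has_vector_derivative 1 + 0) (at s)"
    by (intro has_vector_derivative_add has_vector_derivative_id has_vector_derivative_const)
  from vector_diff_chain_at[OF this assms] show ?thesis by (simp add: o_def)
qed

text \<open>A positive derivative would lift \<open>f\<close> above \<open>f s\<close> just after
  \<open>s\<close>, and monotonicity would keep it there up to \<open>s + L\<close>.\<close>

lemma periodic_mono_deriv_zero:
  fixes f :: "real \<Rightarrow> real"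
  assumes deriv: "\<And>s. (f has_real_derivative f' s) (at s)" and nonneg: "\<And>s. f' s \<ge> 0"
    and per: "\<And>s. f (s + L) = f s" and L: "L > 0"
  shows "f' s = 0"
proof (rule ccontr)
  have mono: "f a \<le> f b" if "a \<le> b" for a b
    by (rule DERIV_nonneg_imp_nondecreasing[OF that]) (use deriv nonneg in blast)
  assume "f' s \<noteq> 0"
  then have "f' s > 0" using nonneg[of s] by linarith
  then obtain d where d: "d > 0" "\<And>h. 0 < h \<Longrightarrow> h < d \<Longrightarrow> f s < f (s + h)"
    using DERIV_pos_inc_right[OF deriv] by blast
  define h where "h = min (d / 2) L"
  have "f s < f (s + h)" using d L by (intro d(2)) (auto simp: h_def)
  also have "f (s + h) \<le> f (s + L)" by (rule mono) (simp add: h_def)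
  finally show False by (simp add: per)
qed

lemma periodic_attained_in_period:
  fixes f :: "real \<Rightarrow> 'a"
  assumes per: "\<And>s. f (s + L) = f s" and L: "L > 0"
  obtains t where "0 \<le> t" "t < L" "f t = f s"
proof
  interpret periodic_fun_simple f L by unfold_locales (rule per)
  let ?n = "\<lfloor>s / L\<rfloor>"
  have "of_int ?n * L \<le> s" "s < (of_int ?n + 1) * L"
    using floor_correct[of "s / L"] by (simp_all only: pos_le_divide_eq[OF L] pos_divide_less_eq[OF L] of_int_add of_int_1)
  then show "0 \<le> s + of_int (- ?n) * L" "s + of_int (- ?n) * L < L"
    by (simp_all add: algebra_simps)
  show "f (s + of_int (- ?n) * L) = f s" by (rule plus_of_int)
qed

lemma periodic_attains_extrema:
  fixes f :: "real \<Rightarrow> real"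
  assumes cont: "continuous_on UNIV f" and per: "\<And>s. f (s + L) = f s" and L: "L > 0"
  obtains a b where "\<And>s. f a \<le> f s" "\<And>s. f s \<le> f b"
proof -
  have *: "compact {0..L}" "{0..L} \<noteq> {}" "continuous_on {0..L} f"
    using L cont by (auto intro: continuous_on_subset)
  obtain a where a: "\<And>t. t \<in> {0..L} \<Longrightarrow> f a \<le> f t"
    using continuous_attains_inf[OF *] by blast
  obtain b where b: "\<And>t. t \<in> {0..L} \<Longrightarrow> f t \<le> f b"
    using continuous_attains_sup[OF *] by blast
  have "f a \<le> f s \<and> f s \<le> f b" for s
  proof -
    obtain t where "0 \<le> t" "t < L" "f t = f s"
      using periodic_attained_in_period[of f, OF per L] .
    then show ?thesis using a[of t] b[of t] by simp
  qed
  then show thesis using that by blast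
qed

text \<open>A pair of conjugate semi-diameters can be turned into principal axes: their inner product
  changes sign after a quarter turn of the parameter.\<close>
lemma ellipse_conjugate_diameters:
  fixes B C :: "real^3"
  assumes indep: "\<And>x y. x *\<^sub>R B + y *\<^sub>R C = 0 \<Longrightarrow> x = 0 \<and> y = 0"
  shows "ellipse {c + cos \<phi> *\<^sub>R B + sin \<phi> *\<^sub>R C |\<phi>. True}"
proof -
  define b where "b = (\<lambda>\<delta>. cos \<delta> *\<^sub>R B + sin \<delta> *\<^sub>R C)"
  define d where "d = (\<lambda>\<delta>. cos \<delta> *\<^sub>R C - sin \<delta> *\<^sub>R B)"
  have cont: "continuous_on {0..pi/2} (\<lambda>\<delta>. b \<delta> \<bullet> d \<delta>)"
    unfolding b_def d_def by (intro continuous_intros)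
  have ends: "b 0 \<bullet> d 0 = B \<bullet> C" "b (pi/2) \<bullet> d (pi/2) = - (B \<bullet> C)"
    by (simp_all add: b_def d_def inner_commute)
  have "\<exists>\<delta>. b \<delta> \<bullet> d \<delta> = 0"
  proof (cases "B \<bullet> C \<le> 0")
    case True
    then show ?thesis
      using IVT'[of "\<lambda>\<delta>. b \<delta> \<bullet> d \<delta>" 0 0 "pi/2"] cont ends by auto
  next
    case False
    then show ?thesis
      using IVT2'[of "\<lambda>\<delta>. b \<delta> \<bullet> d \<delta>" "pi/2" 0 0] cont ends by auto
  qed
  then obtain \<delta> where orth: "b \<delta> \<bullet> d \<delta> = 0" by blast
  have nz: "b \<delta> \<noteq> 0" "d \<delta> \<noteq> 0"
  proof -
    have "cos \<delta> \<noteq> 0 \<or> sin \<delta> \<noteq> 0"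
      using sin_zero_abs_cos_one[of \<delta>] by auto
    moreover have "d \<delta> = (- sin \<delta>) *\<^sub>R B + cos \<delta> *\<^sub>R C"
      by (simp add: d_def)
    ultimately show "b \<delta> \<noteq> 0" "d \<delta> \<noteq> 0"
      using indep[of "cos \<delta>" "sin \<delta>"] indep[of "- sin \<delta>" "cos \<delta>"]
      unfolding b_def by (metis, metis neg_equal_0_iff_equal)
  qed
  have rot: "cos \<phi> *\<^sub>R b \<delta> + sin \<phi> *\<^sub>R d \<delta> = cos (\<phi> + \<delta>) *\<^sub>R B + sin (\<phi> + \<delta>) *\<^sub>R C" for \<phi>
    by (simp add: b_def d_def cos_add sin_add algebra_simps)
  have scale: "(norm v * x) *\<^sub>R sgn v = x *\<^sub>R v" for v :: "real^3" and x
    by (cases "v = 0") (simp_all add: sgn_div_norm mult.commute[of "norm v"] mult.assoc)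
  have "{c + cos \<phi> *\<^sub>R B + sin \<phi> *\<^sub>R C |\<phi>. True}
      = {c + (norm (b \<delta>) * cos \<phi>) *\<^sub>R sgn (b \<delta>) + (norm (d \<delta>) * sin \<phi>) *\<^sub>R sgn (d \<delta>) |\<phi>. True}"
    (is "?E = ?F")
  proof -
    have "c + (norm (b \<delta>) * cos \<phi>) *\<^sub>R sgn (b \<delta>) + (norm (d \<delta>) * sin \<phi>) *\<^sub>R sgn (d \<delta>)
        = c + cos (\<phi> + \<delta>) *\<^sub>R B + sin (\<phi> + \<delta>) *\<^sub>R C" for \<phi>
      using rot[of \<phi>] by (simp add: scale add.assoc)
    then have "?F = {c + cos (\<phi> + \<delta>) *\<^sub>R B + sin (\<phi> + \<delta>) *\<^sub>R C |\<phi>. True}"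
      by (simp only:)
    also have "\<dots> = ?E"
    proof (intro set_eqI iffI)
      fix y assume "y \<in> ?E"
      then obtain \<phi> where "y = c + cos (\<phi> - \<delta> + \<delta>) *\<^sub>R B + sin (\<phi> - \<delta> + \<delta>) *\<^sub>R C" by auto
      then show "y \<in> {c + cos (\<phi> + \<delta>) *\<^sub>R B + sin (\<phi> + \<delta>) *\<^sub>R C |\<phi>. True}" by blast
    qed auto
    finally show ?thesis by simp
  qed
  moreover have "norm (sgn (b \<delta>)) = 1" "norm (sgn (d \<delta>)) = 1" "sgn (b \<delta>) \<bullet> sgn (d \<delta>) = 0"
    using nz orth by (simp_all add: norm_sgn sgn_div_norm)
  ultimately show ?thesis
    unfolding ellipse_def using nz
    by (intro exI[of _ c] exI[of _ "sgn (b \<delta>)"] exI[of _ "sgn (d \<delta>)"]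
        exI[of _ "norm (b \<delta>)"] exI[of _ "norm (d \<delta>)"]) simp
qed

section \<open>The elliptic oscillation of the curvature\<close>

text \<open>The half-angle substitution gives the antiderivative
  \<open>2 * arctan ((m + n) / k * tan (u / 2))\<close>, which is undefined at odd multiples of
  \<open>pi\<close>. Written as \<open>u\<close> plus a periodic correction it is smooth on the
  whole line and visibly gains \<open>2 * pi\<close> per turn.\<close>

lemma half_angle_correction_deriv:
  fixes m n k :: real
  assumes "0 < n" "n < m" "0 < k" "k\<^sup>2 = m\<^sup>2 - n\<^sup>2"
  shows "((\<lambda>u. u + 2 * arctan (n * sin u / (m + k - n * cos u))) has_real_derivative
           k / (m - n * cos u)) (at u)"
proof -
  define D where "D = m + k - n * cos u"
  define N where "N = n * sin u"
  have K: "m - n * cos u > 0"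
    using mult_left_le[OF cos_le_one, of n u] assms by linarith
  then have D: "D > 0" using assms by (simp add: D_def)
  have sq: "(n * sin u)\<^sup>2 + (n * cos u)\<^sup>2 = n\<^sup>2"
    by (metis distrib_left mult.right_neutral power_mult_distrib sin_cos_squared_add)
  have DN: "D\<^sup>2 + N\<^sup>2 = 2 * (m + k) * (m - n * cos u)"
    using sq assms(4) unfolding D_def N_def by algebra
  have num: "n * cos u * D - N * (n * sin u) = (m + k) * (n * cos u - m + k)"
    using sq assms(4) unfolding D_def N_def by algebra
  have mk: "m + k > 0" using assms by auto
  have "((\<lambda>u. n * sin u / (m + k - n * cos u)) has_real_derivative
          (n * cos u * D - N * (n * sin u)) / (D * D)) (at u)"
    unfolding D_def N_def using D
    by (intro DERIV_divide) (auto intro!: derivative_eq_intros simp: D_def)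
  from DERIV_add[OF DERIV_ident DERIV_cmult[OF DERIV_chain2[OF DERIV_arctan this], of 2]]
  have "((\<lambda>u. u + 2 * arctan (n * sin u / (m + k - n * cos u))) has_real_derivative
           1 + 2 * (((n * cos u * D - N * (n * sin u)) / (D * D)) / (1 + (N / D)\<^sup>2))) (at u)"
    by (simp add: D_def N_def divide_inverse mult.commute)
  moreover have "((n * cos u * D - N * (n * sin u)) / (D * D)) / (1 + (N / D)\<^sup>2)
      = (n * cos u * D - N * (n * sin u)) / (D\<^sup>2 + N\<^sup>2)"
    using D by (simp add: divide_simps power2_eq_square add_nonneg_eq_0_iff)
  moreover have "1 + 2 * ((n * cos u * D - N * (n * sin u)) / (D\<^sup>2 + N\<^sup>2)) = k / (m - n * cos u)"
    unfolding DN num using mk K by (simp add: divide_simps) (simp add: algebra_simps)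
  ultimately show ?thesis by (simp only:)
qed

text \<open>The roots of the cubic are \<open>\<alpha>\<close>, \<open>\<beta>\<close> and
  \<open>- (\<alpha> + \<beta>)\<close>, with sum zero. The second-order equation stands beside the
  energy because the energy alone would let \<open>\<kappa>\<close> rest at a turning point.\<close>

locale elliptic_oscillation =
  fixes \<kappa> \<kappa>' :: "real \<Rightarrow> real" and \<alpha> \<beta> :: real
  assumes \<alpha>_pos: "0 < \<alpha>" and \<alpha>_less_\<beta>: "\<alpha> < \<beta>"
    and \<kappa>_ge: "\<alpha> \<le> \<kappa> s"
    and \<kappa>_deriv: "(\<kappa> has_real_derivative \<kappa>' s) (at s)"
    and \<kappa>'_deriv: "(\<kappa>' has_real_derivative
          (\<alpha>\<^sup>2 + \<alpha> * \<beta> + \<beta>\<^sup>2 - 3 * (\<kappa> s)\<^sup>2) / 2) (at s)"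
    and energy: "(\<kappa>' s)\<^sup>2 = (\<kappa> s - \<alpha>) * (\<beta> - \<kappa> s) * (\<kappa> s + \<alpha> + \<beta>)"
begin

section \<open>The phase of the oscillation\<close>

definition "mean = (\<alpha> + \<beta>) / 2"
definition "ampl = (\<beta> - \<alpha>) / 2"
definition "speed u = sqrt (mean - ampl * cos u + \<alpha> + \<beta>)"

lemma ampl_pos: "ampl > 0" and ampl_less_mean: "ampl < mean"
  using \<alpha>_pos \<alpha>_less_\<beta> by (auto simp: ampl_def mean_def)

lemma osc_pos: "mean - ampl * cos u > 0"
proof -
  have "ampl * cos u \<le> ampl" using ampl_pos by simp
  then show ?thesis using ampl_less_mean by linarith
qed

lemma speed_pos: "speed u > 0"
  using osc_pos[of u] \<alpha>_pos \<alpha>_less_\<beta> by (auto simp: speed_def)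

text \<open>By the energy equation \<open>(C s, S s)\<close> lies on the unit circle, and by the
  second-order equation it rotates with angular speed \<open>h s\<close>. Integrating
  \<open>h\<close> gives a phase that passes smoothly through the turning points, where an inverse
  cosine would fail.\<close>

lemma phase_exists:
  "\<exists>\<eta>. \<forall>s. \<kappa> s = mean - ampl * cos (\<eta> s) \<and> \<kappa>' s = ampl * speed (\<eta> s) * sin (\<eta> s) \<and>
       (\<eta> has_real_derivative speed (\<eta> s)) (at s)"
proof -
  define h where "h = (\<lambda>s. sqrt (\<kappa> s + \<alpha> + \<beta>))"
  have hpos: "h s > 0" and h2: "(h s)\<^sup>2 = \<kappa> s + \<alpha> + \<beta>" for s
    using \<kappa>_ge[of s] \<alpha>_pos \<alpha>_less_\<beta> by (auto simp: h_def)
  have dh: "(h has_real_derivative \<kappa>' s / (2 * h s)) (at s)" for s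
  proof -
    have "((\<lambda>s. \<kappa> s + \<alpha> + \<beta>) has_real_derivative \<kappa>' s + 0 + 0) (at s)"
      by (intro derivative_intros \<kappa>_deriv)
    moreover have "\<kappa> s + \<alpha> + \<beta> > 0"
      using \<kappa>_ge[of s] \<alpha>_pos \<alpha>_less_\<beta> by linarith
    ultimately have "((\<lambda>s. sqrt (\<kappa> s + \<alpha> + \<beta>)) has_real_derivative
        inverse (sqrt (\<kappa> s + \<alpha> + \<beta>)) / 2 * (\<kappa>' s + 0 + 0)) (at s)"
      using DERIV_chain2[OF DERIV_real_sqrt, of "\<lambda>s. \<kappa> s + \<alpha> + \<beta>"] by blast
    moreover have "inverse (sqrt (\<kappa> s + \<alpha> + \<beta>)) / 2 * (\<kappa>' s + 0 + 0) = \<kappa>' s / (2 * h s)"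
      by (simp add: h_def field_simps)
    ultimately show ?thesis by (simp only: h_def)
  qed
  define C where "C = (\<lambda>s. (mean - \<kappa> s) / ampl)"
  define S where "S = (\<lambda>s. \<kappa>' s / (ampl * h s))"
  have CS: "(C s)\<^sup>2 + (S s)\<^sup>2 = 1" for s
  proof -
    have "(\<kappa>' s)\<^sup>2 = (\<kappa> s - \<alpha>) * (\<beta> - \<kappa> s) * (h s)\<^sup>2"
      by (simp add: energy h2)
    then have "(S s)\<^sup>2 = (\<kappa> s - \<alpha>) * (\<beta> - \<kappa> s) / ampl\<^sup>2"
      using hpos[of s] by (simp add: S_def power_divide power_mult_distrib)
    then have "(C s)\<^sup>2 + (S s)\<^sup>2 = ((mean - \<kappa> s)\<^sup>2 + (\<kappa> s - \<alpha>) * (\<beta> - \<kappa> s)) / ampl\<^sup>2"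
      by (simp add: C_def power_divide add_divide_distrib)
    also have "(mean - \<kappa> s)\<^sup>2 + (\<kappa> s - \<alpha>) * (\<beta> - \<kappa> s) = ampl\<^sup>2"
      by (simp add: mean_def ampl_def power2_eq_square field_simps)
    finally show ?thesis using ampl_pos by simp
  qed
  have dC: "(C has_vector_derivative (- h s) *\<^sub>R S s) (at s)" for s
  proof -
    have "(C has_real_derivative (0 - \<kappa>' s) / ampl) (at s)"
      unfolding C_def by (intro DERIV_cdivide DERIV_diff DERIV_const \<kappa>_deriv)
    then show ?thesis
      using hpos[of s] ampl_pos by (simp add: S_def has_real_derivative_iff_has_vector_derivative)
  qed
  have dS: "(S has_vector_derivative - (- h s) *\<^sub>R C s) (at s)" for s
  proof -
    have "(\<kappa>' s)\<^sup>2 = (\<kappa> s - \<alpha>) * (\<beta> - \<kappa> s) * (h s)\<^sup>2"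
      by (simp add: energy h2)
    then have "\<kappa>' s * (\<kappa>' s / (2 * h s)) = (\<kappa> s - \<alpha>) * (\<beta> - \<kappa> s) * h s / 2"
      using hpos[of s] by (simp add: field_simps power2_eq_square)
    moreover have "(\<alpha>\<^sup>2 + \<alpha> * \<beta> + \<beta>\<^sup>2 - 3 * (\<kappa> s)\<^sup>2) / 2 =
        (mean - \<kappa> s) * (h s)\<^sup>2 + (\<kappa> s - \<alpha>) * (\<beta> - \<kappa> s) / 2"
      unfolding h2 by (simp add: mean_def power2_eq_square field_simps)
    ultimately have num: "((\<alpha>\<^sup>2 + \<alpha> * \<beta> + \<beta>\<^sup>2 - 3 * (\<kappa> s)\<^sup>2) / 2 * h s - \<kappa>' s * (\<kappa>' s / (2 * h s)))
        = (mean - \<kappa> s) * (h s)^3"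
      by (simp only:) (simp add: field_simps power2_eq_square power3_eq_cube)
    have eq: "((\<alpha>\<^sup>2 + \<alpha> * \<beta> + \<beta>\<^sup>2 - 3 * (\<kappa> s)\<^sup>2) / 2 * h s - \<kappa>' s * (\<kappa>' s / (2 * h s)))
        / (h s * h s) / ampl = h s * C s"
      unfolding num using hpos[of s] ampl_pos by (simp add: C_def power3_eq_cube field_simps)
    have "((\<lambda>s. \<kappa>' s / h s / ampl) has_real_derivative
        ((\<alpha>\<^sup>2 + \<alpha> * \<beta> + \<beta>\<^sup>2 - 3 * (\<kappa> s)\<^sup>2) / 2 * h s - \<kappa>' s * (\<kappa>' s / (2 * h s)))
        / (h s * h s) / ampl) (at s)"
      using hpos[of s] ampl_pos
      by (intro DERIV_cdivide DERIV_divide \<kappa>'_deriv dh) auto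
    then show ?thesis
      unfolding eq by (simp add: S_def has_real_derivative_iff_has_vector_derivative mult.commute)
  qed
  have "continuous_on UNIV h"
    by (rule differentiable_imp_continuous_on_UNIV[OF dh])
  then obtain F where F: "\<And>s. (F has_real_derivative h s) (at s)"
    using real_antiderivative_exists_UNIV by blast
  have F': "((\<lambda>s. - F s) has_real_derivative - h s) (at s)" for s
    by (intro DERIV_minus F)
  obtain c where c: "C 0 = cos c" "S 0 = sin c"
    using sincos_total_2pi[OF CS[of 0]] by metis
  define \<eta> where "\<eta> = (\<lambda>s. F s - F 0 + c)"
  have "C s = cos (\<eta> s)" "S s = sin (\<eta> s)" for s
  proof -
    have neg: "- F s - - F 0 = - (F s - F 0)" by simp
    show "C s = cos (\<eta> s)" "S s = sin (\<eta> s)"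
      using rotating_frame[OF dC dS F', of s 0]
      unfolding \<eta>_def c neg cos_minus sin_minus cos_add sin_add by (simp_all add: mult.commute)
  qed
  then have \<eta>: "(mean - \<kappa> s) / ampl = cos (\<eta> s)" "\<kappa>' s / (ampl * h s) = sin (\<eta> s)" for s
    by (simp_all add: C_def S_def)
  have 1: "\<kappa> s = mean - ampl * cos (\<eta> s)" for s
    using ampl_pos by (simp flip: \<eta>)
  have hs: "h s = speed (\<eta> s)" for s
    by (simp add: h_def speed_def flip: 1)
  have 2: "\<kappa>' s = ampl * speed (\<eta> s) * sin (\<eta> s)" for s
    using ampl_pos hpos[of s] by (simp flip: \<eta> hs)
  have 3: "(\<eta> has_real_derivative speed (\<eta> s)) (at s)" for s
  proof -
    have "((\<lambda>s. F s - F 0 + c) has_real_derivative h s - 0 + 0) (at s)"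
      by (intro DERIV_add DERIV_diff DERIV_const F)
    then show ?thesis unfolding hs[symmetric] by (simp add: \<eta>_def)
  qed
  show ?thesis using 1 2 3 by blast
qed

definition "\<eta> = (SOME \<eta>. \<forall>s. \<kappa> s = mean - ampl * cos (\<eta> s) \<and>
  \<kappa>' s = ampl * speed (\<eta> s) * sin (\<eta> s) \<and> (\<eta> has_real_derivative speed (\<eta> s)) (at s))"

lemma \<kappa>_eq: "\<kappa> s = mean - ampl * cos (\<eta> s)"
  and \<kappa>'_eq: "\<kappa>' s = ampl * speed (\<eta> s) * sin (\<eta> s)"
  and \<eta>_deriv: "(\<eta> has_real_derivative speed (\<eta> s)) (at s)"
  using someI_ex[OF phase_exists] unfolding \<eta>_def[symmetric] by blast+

lemma strict_mono_\<eta>: "strict_mono \<eta>"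
  using \<eta>_deriv speed_pos by (rule pos_deriv_strict_mono)

text \<open>The inverse of \<open>\<eta>\<close> up to an additive constant.\<close>
definition "time_of = (SOME \<Phi>. \<forall>u. (\<Phi> has_real_derivative 1 / speed u) (at u))"

lemma time_of_deriv: "(time_of has_real_derivative 1 / speed u) (at u)"
proof -
  have "continuous_on UNIV (\<lambda>u. 1 / speed u)"
    using speed_pos by (auto intro!: continuous_intros simp: speed_def less_imp_neq[symmetric])
  then have "\<exists>\<Phi>. \<forall>u. (\<Phi> has_real_derivative 1 / speed u) (at u)"
    by (rule real_antiderivative_exists_UNIV)
  from someI_ex[OF this] show ?thesis unfolding time_of_def by blast
qed

lemma strict_mono_time_of: "strict_mono time_of"
  using time_of_deriv by (rule pos_deriv_strict_mono) (simp add: speed_pos)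

section \<open>The period of the oscillation\<close>

definition "period = time_of (2 * pi) - time_of 0"

lemma period_pos: "period > 0"
  using strict_mono_time_of by (simp add: period_def strict_mono_less)

lemma time_of_\<eta>: "time_of (\<eta> s) - time_of (\<eta> t) = s - t"
proof -
  have "((\<lambda>s. time_of (\<eta> s) - s) has_real_derivative 1 / speed (\<eta> s) * speed (\<eta> s) - 1) (at s)" for s
    by (intro derivative_intros DERIV_chain2[OF time_of_deriv \<eta>_deriv])
  then have "time_of (\<eta> s) - s = time_of (\<eta> t) - t"
    using speed_pos by (intro DERIV_isconst_all) (auto simp: less_imp_neq[symmetric])
  then show ?thesis by linarith
qed

lemma time_of_shift: "time_of (u + 2 * pi) = time_of u + period"
proof -
  have "((\<lambda>u. time_of (u + 2 * pi) - time_of u) has_real_derivative 0) (at u)" for u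
    by (rule derivative_eq_intros DERIV_shift[THEN iffD1] time_of_deriv refl)+ (simp add: speed_def)
  then have "time_of (u + 2 * pi) - time_of u = time_of (0 + 2 * pi) - time_of 0"
    by (intro DERIV_isconst_all) auto
  then show ?thesis by (simp add: period_def)
qed

lemma \<eta>_period: "\<eta> (s + period) = \<eta> s + 2 * pi"
proof -
  have "time_of (\<eta> (s + period)) = time_of (\<eta> s + 2 * pi)"
    using time_of_\<eta>[of "s + period" s] by (simp add: time_of_shift)
  then show ?thesis using strict_mono_time_of by (simp add: strict_mono_eq)
qed

lemma \<eta>_period_multiple: "\<eta> (s + real q * period) = \<eta> s + 2 * pi * real q"
proof (induction q)
  case (Suc q)
  have "\<eta> (s + real (Suc q) * period) = \<eta> (s + real q * period + period)"
    by (simp add: algebra_simps)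
  then show ?case by (simp only: \<eta>_period Suc) (simp add: algebra_simps)
qed simp

lemma \<kappa>_period: "\<kappa> (s + period) = \<kappa> s"
  by (simp add: \<kappa>_eq \<eta>_period)

text \<open>A period of \<open>\<kappa>\<close> is also one of \<open>\<kappa>'\<close>. The first
  fixes the cosine of the phase and the second its sine, so the increasing phase advances by a
  positive number of full turns.\<close>

lemma period_multiple:
  assumes "Q > 0" and per: "\<And>s. \<kappa> (s + Q) = \<kappa> s"
  shows "\<exists>q>0. Q = real q * period"
proof -
  have "((\<lambda>s. \<kappa> (s + Q)) has_real_derivative \<kappa>' (0 + Q)) (at 0)"
    by (rule DERIV_shift[THEN iffD1, OF \<kappa>_deriv])
  then have "(\<kappa> has_real_derivative \<kappa>' (0 + Q)) (at 0)"
    unfolding per .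
  from DERIV_unique[OF this \<kappa>_deriv] have "\<kappa>' Q = \<kappa>' 0" by simp
  moreover have c: "cos (\<eta> Q) = cos (\<eta> 0)"
    using per[of 0] ampl_pos by (simp add: \<kappa>_eq)
  ultimately have s: "sin (\<eta> Q) = sin (\<eta> 0)"
    using ampl_pos speed_pos[of "\<eta> 0"] by (simp add: \<kappa>'_eq speed_def)
  have "cos (\<eta> Q - \<eta> 0) = 1"
    by (simp add: cos_diff c s flip: power2_eq_square)
  then obtain j :: int where j: "\<eta> Q - \<eta> 0 = 2 * pi * j"
    by (auto simp: cos_eq_1_iff_int)
  have "\<eta> Q > \<eta> 0" using strict_mono_\<eta> \<open>Q > 0\<close> by (simp add: strict_mono_less)
  then have "0 < 2 * pi * real_of_int j" using j by linarith
  then have "j > 0" using pi_gt_zero by (simp add: zero_less_mult_iff)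
  have "\<eta> Q = \<eta> (0 + real (nat j) * period)"
    using j \<open>j > 0\<close> by (simp only: \<eta>_period_multiple) simp
  then have "Q = real (nat j) * period"
    using strict_mono_\<eta> by (simp add: strict_mono_eq)
  with \<open>j > 0\<close> show ?thesis by (intro exI[of _ "nat j"]) auto
qed

lemma minimal_period_\<kappa>: "minimal_period \<kappa> period"
  unfolding minimal_period_def
proof (intro conjI allI impI)
  fix Q assume Q: "0 < Q \<and> Q < period"
  show "\<exists>s. \<kappa> (s + Q) \<noteq> \<kappa> s"
  proof (rule ccontr)
    assume "\<not> ?thesis"
    with Q obtain q where q: "q > 0" "Q = real q * period"
      using period_multiple[of Q] by auto
    then have "1 * period \<le> Q" unfolding q(2) using period_pos by (intro mult_right_mono) auto
    with Q show False by simp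
  qed
qed (simp_all add: period_pos \<kappa>_period)

text \<open>Both bounds compare \<open>\<theta>\<close> with the angle \<open>\<phi>\<close> for which
  \<open>1/\<kappa> = A + B cos \<phi>\<close>, which satisfies \<open>\<phi>' = sqrt (\<alpha> * \<beta>) * speed / \<kappa>\<close>. The lower bound is
  Jensen's inequality for the convex function \<open>1 / sqrt\<close>: a tangent line estimate integrates
  exactly because \<open>\<kappa> * \<phi>' = sqrt (\<alpha> * \<beta>) * \<eta>'\<close>.\<close>
lemma angle_per_period:
  assumes \<theta>: "\<And>s. (\<theta> has_real_derivative sqrt (\<alpha> * \<beta> * (\<alpha> + \<beta>)) / \<kappa> s) (at s)"
  shows "\<theta> (s + period) - \<theta> s < 2 * pi"
    and "2 * pi * sqrt (2/3) < \<theta> (s + period) - \<theta> s"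
proof -
  define k0 where "k0 = sqrt (\<alpha> * \<beta>)"
  define r where "r = sqrt (\<alpha> + \<beta>)"
  define h0 where "h0 = sqrt (k0 + \<alpha> + \<beta>)"
  have \<beta>_pos: "\<beta> > 0" using \<alpha>_pos \<alpha>_less_\<beta> by simp
  have k0: "k0 > 0" "k0\<^sup>2 = \<alpha> * \<beta>" using \<alpha>_pos \<beta>_pos by (auto simp: k0_def)
  have r: "r > 0" "r\<^sup>2 = \<alpha> + \<beta>" using \<alpha>_pos \<beta>_pos by (auto simp: r_def)
  have h0: "h0 > 0" "h0\<^sup>2 = k0 + \<alpha> + \<beta>" using \<alpha>_pos \<beta>_pos k0 by (auto simp: h0_def)
  define \<phi> where "\<phi> = (\<lambda>u. u + 2 * arctan (ampl * sin u / (mean + k0 - ampl * cos u)))"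
  have k0': "k0\<^sup>2 = mean\<^sup>2 - ampl\<^sup>2"
    unfolding k0(2) by (simp add: mean_def ampl_def power2_eq_square field_simps)
  have \<phi>_deriv: "((\<lambda>s. \<phi> (\<eta> s)) has_real_derivative k0 / \<kappa> s * speed (\<eta> s)) (at s)" for s
  proof -
    have "(\<phi> has_real_derivative k0 / (mean - ampl * cos u)) (at u)" for u
      unfolding \<phi>_def by (rule half_angle_correction_deriv[OF ampl_pos ampl_less_mean k0(1) k0'])
    from DERIV_chain2[OF this \<eta>_deriv] show ?thesis
      by (simp flip: \<kappa>_eq)
  qed
  have \<phi>_period: "\<phi> (\<eta> (s + period)) = \<phi> (\<eta> s) + 2 * pi" for s
    by (simp add: \<phi>_def \<eta>_period)
  have sq: "sqrt (\<alpha> * \<beta> * (\<alpha> + \<beta>)) = k0 * r"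
    by (simp add: k0_def r_def real_sqrt_mult)
  have \<kappa>_pos: "\<kappa> s > 0" for s using osc_pos by (simp add: \<kappa>_eq)
  have sp2: "(speed (\<eta> s))\<^sup>2 = \<kappa> s + \<alpha> + \<beta>" for s
    using \<kappa>_pos[of s] \<alpha>_pos \<beta>_pos by (simp add: speed_def flip: \<kappa>_eq)
  have diff_deriv: "((\<lambda>s. \<phi> (\<eta> s) - \<theta> s) has_real_derivative
      k0 / \<kappa> s * speed (\<eta> s) - k0 * r / \<kappa> s) (at s)" for s
    by (intro DERIV_diff \<phi>_deriv \<theta>[unfolded sq])
  have diff_pos: "k0 / \<kappa> s * speed (\<eta> s) - k0 * r / \<kappa> s > 0" for s
  proof -
    have "r\<^sup>2 < (speed (\<eta> s))\<^sup>2"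
      unfolding r(2) sp2 using \<kappa>_pos[of s] by simp
    then have "r < speed (\<eta> s)"
      by (rule power2_less_imp_less[OF _ less_imp_le[OF speed_pos]])
    then show ?thesis using k0(1) \<kappa>_pos[of s] by (simp add: divide_strict_right_mono)
  qed
  \<comment> \<open>The comparison angle gains exactly \<open>2 * pi\<close> per period and strictly
    outruns \<open>\<theta>\<close>, since \<open>\<kappa> > 0\<close> makes the speed exceed
    \<open>r\<close>.\<close>
  have "strict_mono (\<lambda>s. \<phi> (\<eta> s) - \<theta> s)"
    by (rule pos_deriv_strict_mono[OF diff_deriv diff_pos])
  from strict_monoD[OF this, of s "s + period"] show "\<theta> (s + period) - \<theta> s < 2 * pi"
    by (simp add: \<phi>_period period_pos)

  \<comment> \<open>\<open>G\<close> integrates the error of the tangent line to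
    \<open>1 / sqrt x\<close> at \<open>x = h0\<^sup>2\<close>. This point belongs to
    \<open>\<kappa> = k0\<close>, the average of \<open>\<kappa>\<close> over a period with respect
    to the comparison angle.\<close>
  define G where "G = (\<lambda>s. \<theta> s - r / h0 * \<phi> (\<eta> s) + r * k0 / (2 * h0 ^ 3) * (\<eta> s - \<phi> (\<eta> s)))"
  have "G s \<le> G (s + period)"
  proof (rule DERIV_nonneg_imp_nondecreasing[of s "s + period" G])
    show "s \<le> s + period" using period_pos by simp
    fix t
    let ?h = "speed (\<eta> t)"
    let ?G' = "k0 * r / \<kappa> t - r / h0 * (k0 / \<kappa> t * ?h) + r * k0 / (2 * h0 ^ 3) * (?h - k0 / \<kappa> t * ?h)"
    have "(G has_real_derivative ?G') (at t)"
      unfolding G_def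
      by (intro DERIV_add DERIV_diff DERIV_cmult \<phi>_deriv \<eta>_deriv \<theta>[unfolded sq])
    moreover have "?G' = k0 * r / (\<kappa> t * (2 * h0 ^ 3)) * ((?h - h0)\<^sup>2 * (?h + 2 * h0))"
    proof -
      have "\<kappa> t - k0 = ?h\<^sup>2 - h0\<^sup>2" using sp2[of t] h0 by simp
      then have cubic: "2 * h0 ^ 3 - 2 * h0\<^sup>2 * ?h + ?h * (\<kappa> t - k0) = (?h - h0)\<^sup>2 * (?h + 2 * h0)"
        by (simp only:) (simp add: algebra_simps power2_eq_square power3_eq_cube)
      have "?G' = k0 * r / (\<kappa> t * (2 * h0 ^ 3)) * (2 * h0 ^ 3 - 2 * h0\<^sup>2 * ?h + ?h * (\<kappa> t - k0))"
        using \<kappa>_pos[of t] h0(1) by (simp add: field_simps power2_eq_square power3_eq_cube)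
      then show ?thesis unfolding cubic .
    qed
    moreover have "\<dots> \<ge> 0"
      using k0 r \<kappa>_pos[of t] h0 speed_pos[of "\<eta> t"] by (intro mult_nonneg_nonneg divide_nonneg_nonneg) auto
    ultimately show "\<exists>y. (G has_real_derivative y) (at t) \<and> 0 \<le> y" by auto
  qed
  moreover have "\<eta> (s + period) - \<phi> (\<eta> (s + period)) = \<eta> s - \<phi> (\<eta> s)"
    unfolding \<phi>_period by (simp add: \<eta>_period)
  ultimately have "r / h0 * (2 * pi) \<le> \<theta> (s + period) - \<theta> s"
    unfolding G_def by (simp only: \<phi>_period) (simp add: algebra_simps)
  moreover have "sqrt (2/3) < r / h0"
  proof -
    \<comment> \<open>The constant 2/3 comes from the inequality of arithmetic and geometric means,
      \<open>2 * k0 < \<alpha> + \<beta>\<close>.\<close>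
    have "0 < (sqrt \<beta> - sqrt \<alpha>)\<^sup>2" using \<alpha>_less_\<beta> by simp
    also have "\<dots> = \<beta> + \<alpha> - 2 * k0"
      using \<alpha>_pos \<beta>_pos by (simp add: k0_def power2_diff real_sqrt_mult)
    finally have "2/3 < (\<alpha> + \<beta>) / (k0 + \<alpha> + \<beta>)"
      using k0 \<alpha>_pos \<beta>_pos by (simp add: field_simps)
    then show ?thesis by (simp add: r_def h0_def flip: real_sqrt_divide)
  qed
  ultimately show "2 * pi * sqrt (2/3) < \<theta> (s + period) - \<theta> s"
    using mult_strict_left_mono[of "sqrt (2/3)" "r / h0" "2 * pi"] by (simp add: mult.commute)
qed

end

section \<open>Curves on the light cone\<close>

lemma lorentz_bounded_bilinear: "bounded_bilinear (\<bullet>\<^sub>L)"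
proof -
  have "bilinear (\<bullet>\<^sub>L)"
    by (auto simp: bilinear_def lorentz_inner_def algebra_simps intro!: linearI)
  then show ?thesis by (simp add: bilinear_conv_bounded_bilinear)
qed

interpretation lorentz: bounded_bilinear "(\<bullet>\<^sub>L)"
  by (rule lorentz_bounded_bilinear)

lemmas lorentz_simps =
  lorentz.add_left lorentz.add_right lorentz.diff_left lorentz.diff_right
  lorentz.minus_left lorentz.minus_right lorentz.scaleR_left lorentz.scaleR_right
  lorentz.zero_left lorentz.zero_right

lemma lorentz_commute: "u \<bullet>\<^sub>L v = v \<bullet>\<^sub>L u"
  by (simp add: lorentz_inner_def algebra_simps)

lemma lorentz_has_derivative:
  assumes "(f has_vector_derivative f') (at s)" "(g has_vector_derivative g') (at s)"
  shows "((\<lambda>s. f s \<bullet>\<^sub>L g s) has_real_derivative f' \<bullet>\<^sub>L g s + f s \<bullet>\<^sub>L g') (at s)"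
  using lorentz.has_vector_derivative[OF assms]
  by (simp add: has_real_derivative_iff_has_vector_derivative add.commute)

lemma nth_has_derivative:
  assumes "(f has_vector_derivative f') (at s)"
  shows "((\<lambda>s. f s $ i) has_real_derivative f' $ i) (at s)"
  using bounded_linear.has_vector_derivative[OF bounded_linear_vec_nth assms]
  by (simp add: has_real_derivative_iff_has_vector_derivative)

lemma const_imp_deriv_zero:
  fixes f :: "real \<Rightarrow> real"
  assumes "\<And>s. f s = c" "(f has_real_derivative d) (at s)"
  shows "d = 0"
proof -
  have "f = (\<lambda>_. c)" by (rule ext) (rule assms(1))
  with assms(2) have "((\<lambda>_. c) has_real_derivative d) (at s)" by simp
  then show ?thesis using DERIV_const by (rule DERIV_unique)
qed

locale cone_curve =
  fixes r :: "real \<Rightarrow> real^3"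
  assumes cone_curve: "light_cone_curve r"
begin

declare One_nat_def [simp del] One_nat_def [symmetric, simp]

definition "D n = ((\<lambda>g t. vector_derivative g (at t)) ^^ n) r"

lemma D_0: "D 0 = r" by (simp add: D_def)

lemma D_Suc: "D (Suc n) s = vector_derivative (D n) (at s)"
  by (simp add: D_def)

lemma D_1: "D 1 = tangent r"
  using D_Suc[of 0] by (simp add: fun_eq_iff D_0 tangent_def)

lemma D_deriv: "(D n has_vector_derivative D (Suc n) s) (at s)"
proof -
  have "D n differentiable at s"
    using cone_curve unfolding light_cone_curve_def smooth_curve_def D_def by blast
  then show ?thesis by (simp add: D_Suc vector_derivative_works)
qed

lemma DD_deriv: "((\<lambda>s. D m s \<bullet>\<^sub>L D n s) has_real_derivative
    D (Suc m) s \<bullet>\<^sub>L D n s + D m s \<bullet>\<^sub>L D (Suc n) s) (at s)"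
  by (rule lorentz_has_derivative[OF D_deriv D_deriv])

definition "\<theta> = (SOME \<theta>. angle_function r \<theta> \<and> (\<forall>s. (\<theta> has_real_derivative 1 / (r s $ 1)) (at s)))"

lemma angle: "angle_function r \<theta>" and \<theta>_deriv: "(\<theta> has_real_derivative 1 / (r s $ 1)) (at s)"
proof -
  have "\<exists>\<theta>. angle_function r \<theta> \<and> (\<forall>s. (\<theta> has_real_derivative 1 / (r s $ 1)) (at s))"
    using cone_curve unfolding light_cone_curve_def by blast
  from someI_ex[OF this] show "angle_function r \<theta>" "(\<theta> has_real_derivative 1 / (r s $ 1)) (at s)"
    unfolding \<theta>_def by blast+
qed

lemma r_1_pos: "r s $ 1 > 0"
proof -
  have "r s \<in> light_cone" using cone_curve unfolding light_cone_curve_def by blast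
  then show ?thesis by (auto simp: light_cone_def)
qed

lemma r_2: "r s $ 2 = r s $ 1 * cos (\<theta> s)" and r_3: "r s $ 3 = r s $ 1 * sin (\<theta> s)"
  by (rule angle_function_nth[OF angle])+

lemma T_2: "D 1 s $ 2 = D 1 s $ 1 * cos (\<theta> s) - sin (\<theta> s)"
  and T_3: "D 1 s $ 3 = D 1 s $ 1 * sin (\<theta> s) + cos (\<theta> s)"
proof -
  have nth: "((\<lambda>s. r s $ i) has_real_derivative D 1 s $ i) (at s)" for i
    using nth_has_derivative[OF D_deriv[of 0 s]] by (simp add: D_0)
  have c: "((\<lambda>s. cos (\<theta> s)) has_real_derivative - sin (\<theta> s) * (1 / r s $ 1)) (at s)"
    by (rule DERIV_chain2[OF DERIV_cos \<theta>_deriv])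
  have s: "((\<lambda>s. sin (\<theta> s)) has_real_derivative cos (\<theta> s) * (1 / r s $ 1)) (at s)"
    by (rule DERIV_chain2[OF DERIV_sin \<theta>_deriv])
  show "D 1 s $ 2 = D 1 s $ 1 * cos (\<theta> s) - sin (\<theta> s)"
    using DERIV_unique[OF nth[of 2, unfolded r_2] DERIV_mult[OF nth[of 1] c]] r_1_pos[of s]
    by simp
  show "D 1 s $ 3 = D 1 s $ 1 * sin (\<theta> s) + cos (\<theta> s)"
    using DERIV_unique[OF nth[of 3, unfolded r_3] DERIV_mult[OF nth[of 1] s]] r_1_pos[of s]
    by simp
qed

text \<open>Up to sign, the Lorentzian cross product of \<open>r\<close> and its tangent is
  \<open>r\<close> itself: the tangent plane of the cone has the null direction \<open>r\<close> as
  its normal. The orientation of the curve fixes the sign.\<close>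

lemma r_cross_T:
  "r s $ 1 * D 1 s $ 2 - r s $ 2 * D 1 s $ 1 = - r s $ 3"
  "r s $ 3 * D 1 s $ 1 - r s $ 1 * D 1 s $ 3 = - r s $ 2"
  "r s $ 2 * D 1 s $ 3 - r s $ 3 * D 1 s $ 2 = r s $ 1"
proof -
  have sc: "cos (\<theta> s) * cos (\<theta> s) + sin (\<theta> s) * sin (\<theta> s) = 1"
    by (simp flip: power2_eq_square)
  show "r s $ 1 * D 1 s $ 2 - r s $ 2 * D 1 s $ 1 = - r s $ 3"
    "r s $ 3 * D 1 s $ 1 - r s $ 1 * D 1 s $ 3 = - r s $ 2"
    unfolding r_2 r_3 T_2 T_3 by (simp_all add: algebra_simps)
  show "r s $ 2 * D 1 s $ 3 - r s $ 3 * D 1 s $ 2 = r s $ 1"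
    unfolding r_2 r_3 T_2 T_3 using sc by algebra
qed

text \<open>Two points of the cone thus have a nonpositive product, which vanishes exactly when they
  lie on the same null ray.\<close>

lemma r_lorentz_r: "r s \<bullet>\<^sub>L r t = - (r s $ 1 * r t $ 1 * (1 - cos (\<theta> s - \<theta> t)))"
  by (simp add: lorentz_inner_def r_2 r_3 cos_diff algebra_simps)

text \<open>This is the geodesic curvature, as \<open>geodesic_curvature_eq\<close> shows. Written
  through products of derivatives of the curve, it and its successive derivatives \<open>k1\<close>,
  \<open>k2\<close>, \<open>k3\<close> are differentiable without any appeal to
  \<open>Y_field\<close>.\<close>

definition "k s = - (D 2 s \<bullet>\<^sub>L D 2 s) / 2"
definition "k1 s = - (D 2 s \<bullet>\<^sub>L D 3 s)"
definition "k2 s = - (D 3 s \<bullet>\<^sub>L D 3 s + D 2 s \<bullet>\<^sub>L D 4 s)"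
definition "k3 s = - (3 * (D 3 s \<bullet>\<^sub>L D 4 s) + D 2 s \<bullet>\<^sub>L D 5 s)"

lemma k_deriv: "(k has_real_derivative k1 s) (at s)"
  using DERIV_cdivide[OF DERIV_minus[OF DD_deriv[of 2 2 s]], of 2]
  by (simp add: k_def[abs_def] k1_def lorentz_commute)

lemma k1_deriv: "(k1 has_real_derivative k2 s) (at s)"
  using DERIV_minus[OF DD_deriv[of 2 3 s]]
  by (simp add: k1_def[abs_def] k2_def)

lemma k2_deriv: "(k2 has_real_derivative k3 s) (at s)"
  using DERIV_minus[OF DERIV_add[OF DD_deriv[of 3 3 s] DD_deriv[of 2 4 s]]]
  by (simp add: k2_def[abs_def] k3_def lorentz_commute)

section \<open>The Gram matrix and the structure equation\<close>

lemma gram_00: "D 0 s \<bullet>\<^sub>L D 0 s = 0"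
  by (simp add: D_0 r_lorentz_r)

lemma gram_11: "D 1 s \<bullet>\<^sub>L D 1 s = 1"
  using cone_curve unfolding light_cone_curve_def D_1 by blast

lemma gram_22: "D 2 s \<bullet>\<^sub>L D 2 s = - 2 * k s"
  by (simp add: k_def)

lemma gram_01: "D 0 s \<bullet>\<^sub>L D 1 s = 0"
  using const_imp_deriv_zero[OF gram_00 DD_deriv] by (simp add: lorentz_commute)

lemma gram_02: "D 0 s \<bullet>\<^sub>L D 2 s = - 1"
  using const_imp_deriv_zero[OF gram_01 DD_deriv, of s] gram_11[of s]
  by simp

lemma gram_12: "D 1 s \<bullet>\<^sub>L D 2 s = 0"
  using const_imp_deriv_zero[OF gram_11 DD_deriv, of s]
  by (simp add: lorentz_commute)

lemma gram_03: "D 0 s \<bullet>\<^sub>L D 3 s = 0"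
  using const_imp_deriv_zero[OF gram_02 DD_deriv, of s] gram_12[of s]
  by simp

lemma gram_13: "D 1 s \<bullet>\<^sub>L D 3 s = 2 * k s"
  using const_imp_deriv_zero[OF gram_12 DD_deriv, of s] gram_22[of s]
  by simp

lemma gram_23: "D 2 s \<bullet>\<^sub>L D 3 s = - k1 s"
  by (simp add: k1_def)

lemmas gram_upper = gram_01 gram_02 gram_03 gram_12 gram_13 gram_23

lemmas gram = gram_00 gram_11 gram_22 gram_upper gram_upper[THEN trans[OF lorentz_commute]]

text \<open>Orthogonality to \<open>r\<close> and to its tangent forces \<open>v\<close> to be a
  multiple of \<open>r\<close>. As \<open>r\<close> and \<open>D 2 s\<close> have product -1, the
  third condition makes the factor zero.\<close>

lemma frame_nondegenerate:
  assumes "v \<bullet>\<^sub>L D 0 s = 0" "v \<bullet>\<^sub>L D 1 s = 0" "v \<bullet>\<^sub>L D 2 s = 0"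
  shows "v = 0"
proof -
  let ?c = "cos (\<theta> s)" and ?s = "sin (\<theta> s)"
  have "r s $ 1 * (- v $ 1 + v $ 2 * ?c + v $ 3 * ?s) = 0"
    using assms(1) by (simp add: D_0 lorentz_inner_def r_2 r_3 algebra_simps)
  then have 1: "- v $ 1 + v $ 2 * ?c + v $ 3 * ?s = 0"
    using r_1_pos[of s] by simp
  have "D 1 s $ 1 * (- v $ 1 + v $ 2 * ?c + v $ 3 * ?s) + (v $ 3 * ?c - v $ 2 * ?s) = 0"
    using assms(2) by (simp add: lorentz_inner_def T_2 T_3 algebra_simps)
  with 1 have 2: "v $ 3 * ?c - v $ 2 * ?s = 0" by simp
  have sc: "?c * ?c + ?s * ?s = 1" by (simp flip: power2_eq_square)
  have "v $ 2 = v $ 1 * ?c" "v $ 3 = v $ 1 * ?s"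
    using 1 2 sc by algebra+
  then have v: "v = (v $ 1 / r s $ 1) *\<^sub>R D 0 s"
    using r_1_pos[of s] by (simp add: vec_eq_iff forall_3 D_0 r_2 r_3)
  have "v \<bullet>\<^sub>L D 2 s = - (v $ 1 / r s $ 1)"
    by (subst v) (simp add: lorentz_simps gram)
  then have "v $ 1 = 0" using assms(3) r_1_pos[of s] by simp
  then show ?thesis by (subst v) simp
qed

lemma D_3: "D 3 s = (2 * k s) *\<^sub>R D 1 s + k1 s *\<^sub>R D 0 s"
proof -
  have "D 3 s - ((2 * k s) *\<^sub>R D 1 s + k1 s *\<^sub>R D 0 s) = 0"
    by (rule frame_nondegenerate[of _ s]) (simp_all add: lorentz_simps gram)
  then show ?thesis by simp
qed

lemma Y_field_eq: "Y_field r s = k s *\<^sub>R D 0 s - D 2 s"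
  unfolding Y_field_def
proof (rule the_equality)
  let ?y = "k s *\<^sub>R D 0 s - D 2 s"
  have y0: "D 0 s \<bullet>\<^sub>L ?y = 1" by (simp add: lorentz_simps gram)
  have "?y \<noteq> 0"
  proof
    assume e: "?y = 0"
    have "D 0 s \<bullet>\<^sub>L ?y = 0" unfolding e by (rule lorentz.zero_right)
    with y0 show False by linarith
  qed
  then have "light_like ?y \<and> ?y \<bullet>\<^sub>L D 1 s = 0 \<and> D 0 s \<bullet>\<^sub>L ?y = 1"
    using y0 by (simp add: light_like_def lorentz_simps gram)
  then show "light_like ?y \<and> ?y \<bullet>\<^sub>L tangent r s = 0 \<and> r s \<bullet>\<^sub>L ?y = 1"
    by (simp only: D_0 D_1)
  fix y assume "light_like y \<and> y \<bullet>\<^sub>L tangent r s = 0 \<and> r s \<bullet>\<^sub>L y = 1"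
  then have y: "y \<bullet>\<^sub>L y = 0" "y \<bullet>\<^sub>L D 1 s = 0" "y \<bullet>\<^sub>L D 0 s = 1"
    by (auto simp: light_like_def D_0 D_1 lorentz_commute)
  \<comment> \<open>The two linear conditions leave the line \<open>?y - l *\<^sub>R D 0 s\<close>;
    being light-like singles out \<open>l = 0\<close>.\<close>
  define l where "l = y \<bullet>\<^sub>L D 2 s - k s"
  have "y - ?y + l *\<^sub>R D 0 s = 0"
    by (rule frame_nondegenerate[of _ s]) (simp_all add: lorentz_simps gram y l_def)
  then have y_eq: "y = ?y - l *\<^sub>R D 0 s" by (simp add: algebra_simps)
  have "y \<bullet>\<^sub>L y = - 2 * l"
    by (subst (1 2) y_eq) (simp add: lorentz_simps gram algebra_simps)
  then show "y = ?y" using y(1) y_eq by simp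
qed

lemma geodesic_curvature_eq: "geodesic_curvature r s = k s"
proof -
  have "vector_derivative (tangent r) (at s) = D 2 s"
    using D_Suc[of 1 s] by (simp flip: D_1)
  then show ?thesis
    by (simp add: geodesic_curvature_def Y_field_eq lorentz_simps gram)
qed

section \<open>The velocity of the flow and the soliton equation\<close>

definition "V s = k1 s *\<^sub>R D 0 s - k s *\<^sub>R D 1 s"
definition "V1 s = k2 s *\<^sub>R D 0 s - k s *\<^sub>R D 2 s"
definition "V2 s = k3 s *\<^sub>R D 0 s + k2 s *\<^sub>R D 1 s - (k1 s *\<^sub>R D 2 s + k s *\<^sub>R D 3 s)"

lemma kD_deriv:
  assumes "(f has_real_derivative f') (at s)"
  shows "((\<lambda>s. f s *\<^sub>R D n s) has_vector_derivative f' *\<^sub>R D n s + f s *\<^sub>R D (Suc n) s) (at s)"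
  using has_vector_derivative_scaleR[OF assms D_deriv] by (simp add: add.commute)

lemma V_deriv: "(V has_vector_derivative V1 s) (at s)"
  using has_vector_derivative_diff[OF kD_deriv[OF k1_deriv, of 0] kD_deriv[OF k_deriv, of 1]]
  by (simp add: V_def[abs_def] V1_def)

lemma V1_deriv: "(V1 has_vector_derivative V2 s) (at s)"
  using has_vector_derivative_diff[OF kD_deriv[OF k2_deriv, of 0] kD_deriv[OF k_deriv, of 2]]
  by (simp add: V1_def[abs_def] V2_def)

text \<open>A motion by isometries makes its initial velocity \<open>V\<close> a Killing field along the
  curve.\<close>
lemma soliton_velocity_skew:
  assumes "soliton r"
  shows "V s \<bullet>\<^sub>L D 0 t + D 0 s \<bullet>\<^sub>L V t = 0"
proof -
  obtain \<epsilon> A where e: "\<epsilon> > 0" and A: "\<And>t. t \<in> {-\<epsilon><..<\<epsilon>} \<Longrightarrow> lorentz_transformation (A t)"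
    and A0: "A 0 = id" and flow: "third_order_flow {-\<epsilon><..<\<epsilon>} (\<lambda>t s. A t (r s))"
    using assms unfolding soliton_def by blast
  have "deriv (geodesic_curvature r) u = k1 u" for u
    using DERIV_imp_deriv[OF k_deriv] by (simp add: geodesic_curvature_eq[abs_def])
  then have vel: "((\<lambda>\<tau>. A \<tau> (r u)) has_vector_derivative V u) (at 0)" for u
    using flow e unfolding third_order_flow_def
    by (auto dest!: bspec[of _ _ 0] simp: A0 V_def D_0 D_1 geodesic_curvature_eq)
  have d: "((\<lambda>\<tau>. A \<tau> (r s) \<bullet>\<^sub>L A \<tau> (r t)) has_real_derivative
      V s \<bullet>\<^sub>L r t + r s \<bullet>\<^sub>L V t) (at 0)"
    using lorentz_has_derivative[OF vel vel, of s t] by (simp add: A0)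
  have "((\<lambda>\<tau>. A \<tau> (r s) \<bullet>\<^sub>L A \<tau> (r t)) has_real_derivative 0) (at 0)"
  proof (rule has_field_derivative_transform_within_open[of "\<lambda>_. r s \<bullet>\<^sub>L r t" _ _ "{-\<epsilon><..<\<epsilon>}"])
    fix \<tau> assume "\<tau> \<in> {-\<epsilon><..<\<epsilon>}"
    then show "r s \<bullet>\<^sub>L r t = A \<tau> (r s) \<bullet>\<^sub>L A \<tau> (r t)"
      using A unfolding lorentz_transformation_def by simp
  qed (use e in auto)
  from DERIV_unique[OF d this] show ?thesis by (simp add: D_0)
qed

text \<open>In the skew identity \<open>s\<close> and \<open>t\<close> are independent, so it can be
  differentiated twice in each. On the diagonal the result says that \<open>V2 s\<close> and
  \<open>D 2 s\<close> are orthogonal, which is the equation.\<close>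

lemma soliton_equation:
  assumes "soliton r"
  shows "k3 s = 3 * k s * k1 s"
proof -
  note H0 = soliton_velocity_skew[OF assms]
  note const = has_vector_derivative_const
  have H1: "V s \<bullet>\<^sub>L D 1 t + D 0 s \<bullet>\<^sub>L V1 t = 0" for s t
    using const_imp_deriv_zero[OF H0 DERIV_add[OF
        lorentz_has_derivative[OF const D_deriv[of 0]] lorentz_has_derivative[OF const V_deriv]], of t s]
    by (simp add: lorentz_simps)
  have H2: "V s \<bullet>\<^sub>L D 2 t + D 0 s \<bullet>\<^sub>L V2 t = 0" for s t
    using const_imp_deriv_zero[OF H1 DERIV_add[OF
        lorentz_has_derivative[OF const D_deriv[of 1]] lorentz_has_derivative[OF const V1_deriv]], of t s]
    by (simp add: lorentz_simps)
  have H3: "V1 s \<bullet>\<^sub>L D 2 t + D 1 s \<bullet>\<^sub>L V2 t = 0" for s t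
    using const_imp_deriv_zero[OF H2 DERIV_add[OF
        lorentz_has_derivative[OF V_deriv const] lorentz_has_derivative[OF D_deriv[of 0] const]], of s t]
    by (simp add: lorentz_simps)
  have H4: "V2 s \<bullet>\<^sub>L D 2 t + D 2 s \<bullet>\<^sub>L V2 t = 0" for s t
    using const_imp_deriv_zero[OF H3 DERIV_add[OF
        lorentz_has_derivative[OF V1_deriv const] lorentz_has_derivative[OF D_deriv[of 1] const]], of s t]
    by (simp add: lorentz_simps)
  have "V2 s \<bullet>\<^sub>L D 2 s = - k3 s + 3 * k s * k1 s"
    unfolding V2_def by (simp add: lorentz_simps gram)
  then show ?thesis
    using H4[of s s] by (simp add: lorentz_commute)
qed

end

section \<open>Closed solitons\<close>

locale closed_soliton = cone_curve r for r +
  fixes L :: real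
  assumes soliton: "soliton r" and closed: "closed_curve r L"
begin

lemma L_pos: "L > 0" and r_period: "r (s + L) = r s"
  using closed unfolding closed_curve_def minimal_period_def by auto

lemma L_minimal: "0 < Q \<Longrightarrow> (\<And>s. r (s + Q) = r s) \<Longrightarrow> L \<le> Q"
  using closed unfolding closed_curve_def minimal_period_def by (meson not_le)

lemma D_period: "D n (s + L) = D n s"
proof (induction n arbitrary: s)
  case 0
  then show ?case by (simp add: D_0 r_period)
next
  case (Suc n)
  have "((\<lambda>s. D n (s + L)) has_vector_derivative D (Suc n) (s + L)) (at s)"
    by (rule has_vector_derivative_shift[OF D_deriv])
  then have "(D n has_vector_derivative D (Suc n) (s + L)) (at s)"
    unfolding Suc.IH .
  then show ?case by (rule vector_derivative_unique_at[OF _ D_deriv])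
qed

lemma k_period: "k (s + L) = k s"
  by (simp add: k_def D_period)

lemma k2_deriv_soliton: "(k2 has_real_derivative 3 * k s * k1 s) (at s)"
  using k2_deriv[of s] by (simp only: soliton_equation[OF soliton])

text \<open>\<open>k\<close> itself solves the linear equation \<open>u''' = 2 k u' + k' u\<close> satisfied by the coordinates
  of the curve, so it is a fixed linear functional \<open>pole\<close> of the curve.\<close>
definition "pole = (2 * (k 0)\<^sup>2 - k2 0) *\<^sub>R D 0 0 + k1 0 *\<^sub>R D 1 0 - k 0 *\<^sub>R D 2 0"

text \<open>The right-hand side has zero derivative by \<open>D_3\<close> and the soliton equation,
  so its value at 0 is its value everywhere.\<close>

lemma pole_eq: "pole = (2 * (k s)\<^sup>2 - k2 s) *\<^sub>R D 0 s + k1 s *\<^sub>R D 1 s - k s *\<^sub>R D 2 s"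
proof -
  define a where "a = (\<lambda>s. (2 * (k s)\<^sup>2 - k2 s) *\<^sub>R D 0 s + k1 s *\<^sub>R D 1 s - k s *\<^sub>R D 2 s)"
  have c: "((\<lambda>s. 2 * (k s)\<^sup>2 - k2 s) has_real_derivative 4 * k s * k1 s - 3 * k s * k1 s) (at s)" for s
    using DERIV_diff[OF DERIV_cmult[OF DERIV_power[OF k_deriv, of 2], of 2] k2_deriv_soliton, of s]
    by (simp add: mult_ac)
  have "(a has_vector_derivative
      ((4 * k s * k1 s - 3 * k s * k1 s) *\<^sub>R D 0 s + (2 * (k s)\<^sup>2 - k2 s) *\<^sub>R D (Suc 0) s)
      + (k2 s *\<^sub>R D 1 s + k1 s *\<^sub>R D (Suc 1) s) - (k1 s *\<^sub>R D 2 s + k s *\<^sub>R D (Suc 2) s)) (at s)" for s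
    unfolding a_def
    by (intro has_vector_derivative_add has_vector_derivative_diff kD_deriv c k1_deriv k_deriv)
  moreover have "((4 * k s * k1 s - 3 * k s * k1 s) *\<^sub>R D 0 s + (2 * (k s)\<^sup>2 - k2 s) *\<^sub>R D (Suc 0) s)
      + (k2 s *\<^sub>R D 1 s + k1 s *\<^sub>R D (Suc 1) s) - (k1 s *\<^sub>R D 2 s + k s *\<^sub>R D (Suc 2) s) = 0" for s
    by (simp add: D_3 algebra_simps power2_eq_square)
  ultimately have "(a has_vector_derivative 0) (at s)" for s by simp
  from vector_derivative_zero_imp_const[OF this, of 0 s] show ?thesis
    by (simp add: a_def pole_def)
qed

lemma r_pole: "D 0 s \<bullet>\<^sub>L pole = k s"
  by (simp add: pole_eq[of s] lorentz_simps gram)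

lemma T_pole: "D 1 s \<bullet>\<^sub>L pole = k1 s"
  by (simp add: pole_eq[of s] lorentz_simps gram)

lemma pole_pole: "pole \<bullet>\<^sub>L pole = 2 * (k s)^3 - 2 * k s * k2 s + (k1 s)\<^sup>2"
proof -
  have "pole \<bullet>\<^sub>L pole =
      ((2 * (k s)\<^sup>2 - k2 s) *\<^sub>R D 0 s + k1 s *\<^sub>R D 1 s - k s *\<^sub>R D 2 s) \<bullet>\<^sub>L
      ((2 * (k s)\<^sup>2 - k2 s) *\<^sub>R D 0 s + k1 s *\<^sub>R D 1 s - k s *\<^sub>R D 2 s)"
    by (simp only: pole_eq[of s, symmetric])
  then show ?thesis
    by (simp add: lorentz_simps gram algebra_simps power2_eq_square power3_eq_cube)
qed

section \<open>First integrals of the curvature equation\<close>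

definition "c2 = 2 * k2 0 - 3 * (k 0)\<^sup>2"

text \<open>Integrating \<open>2 k''' = 6 k k'\<close> once leaves the constant
  \<open>c2\<close>.\<close>

lemma k2_eq: "k2 s = (3 * (k s)\<^sup>2 + c2) / 2"
proof -
  have "((\<lambda>s. 2 * k2 s - 3 * (k s)\<^sup>2) has_real_derivative 0) (at s)" for s
    using DERIV_diff[OF DERIV_cmult[OF k2_deriv_soliton, of 2] DERIV_cmult[OF DERIV_power[OF k_deriv, of 2], of 3], of s]
    by (simp add: mult_ac)
  then have "2 * k2 s - 3 * (k s)\<^sup>2 = c2"
    unfolding c2_def by (rule DERIV_isconst_all[rotated, rule_format]) 
  then show ?thesis by simp
qed

text \<open>This is the energy integral, a Weierstrass-type equation. Its constant term is the
  Lorentz square of the pole, and the missing quadratic term makes the roots sum to zero.\<close>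

lemma k1_sq: "(k1 s)\<^sup>2 = (k s)^3 + c2 * k s + pole \<bullet>\<^sub>L pole"
  unfolding pole_pole[of s] k2_eq by (simp add: algebra_simps power2_eq_square power3_eq_cube)

text \<open>\<open>k r' - k' r\<close> is the Lorentzian cross product of \<open>pole\<close> and \<open>r\<close>, and also the derivative
  of a periodic vector field. Integrating over a period, \<open>pole\<close> is parallel to the integral of
  \<open>r\<close>, which is time-like.\<close>
lemma k_nonzero:
  assumes nonconst: "k s\<^sub>1 \<noteq> k s\<^sub>2"
  shows "k s \<noteq> 0"
proof
  assume k0: "k s = 0"
  have "continuous_on UNIV r"
    using D_deriv[of 0] unfolding D_0
    by (intro continuous_at_imp_continuous_on ballI) (rule has_vector_derivative_continuous)
  then obtain X where X: "\<And>s. (X has_vector_derivative r s) (at s)"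
    using antiderivative_exists_UNIV by blast
  \<comment> \<open>The factor 3/2 turns the derivative \<open>2 k r' + k' r\<close> of
    \<open>D 2\<close> into a multiple of \<open>k r' - k' r\<close>.\<close>
  define E where "E = (\<lambda>s. D 2 s - ((3/2) * k s) *\<^sub>R D 0 s)"
  have E_deriv: "(E has_vector_derivative (k s *\<^sub>R D 1 s - k1 s *\<^sub>R D 0 s) /\<^sub>R 2) (at s)" for s
  proof -
    have "(E has_vector_derivative D (Suc 2) s - ((3/2) * k1 s) *\<^sub>R D 0 s - ((3/2) * k s) *\<^sub>R D (Suc 0) s) (at s)"
      using has_vector_derivative_diff[OF D_deriv[of 2] kD_deriv[OF DERIV_cmult[OF k_deriv], of "3/2" 0], of s]
      by (simp add: E_def diff_diff_eq)
    moreover have "D (Suc 2) s - ((3/2) * k1 s) *\<^sub>R D 0 s - ((3/2) * k s) *\<^sub>R D (Suc 0) s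
        = (k s *\<^sub>R D 1 s - k1 s *\<^sub>R D 0 s) /\<^sub>R 2"
      by (simp add: D_3 vec_eq_iff field_simps)
    ultimately show ?thesis by simp
  qed
  have EL: "E L = E 0"
    using D_period[of _ 0] k_period[of 0] by (simp add: E_def)
  define M where "M = X L - X 0"
  have kk: "k s = - (pole$1 * r s$1) + pole$2 * r s$2 + pole$3 * r s$3"
    "k1 s = - (pole$1 * D 1 s$1) + pole$2 * D 1 s$2 + pole$3 * D 1 s$3" for s
    using r_pole[of s] T_pole[of s] by (simp_all add: lorentz_inner_def D_0 mult.commute)
  have cross: "pole$j * M$i - pole$i * M$j = 0"
    if "\<And>s. (k s *\<^sub>R D 1 s - k1 s *\<^sub>R D 0 s)$l = pole$j * r s$i - pole$i * r s$j" for i j l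
  proof -
    have "((\<lambda>s. 2 * E s$l - (pole$j * X s$i - pole$i * X s$j)) has_real_derivative
        2 * ((k s *\<^sub>R D 1 s - k1 s *\<^sub>R D 0 s) /\<^sub>R 2)$l - (pole$j * r s$i - pole$i * r s$j)) (at s)" for s
      by (intro DERIV_diff DERIV_cmult nth_has_derivative E_deriv X)
    moreover have "2 * ((k s *\<^sub>R D 1 s - k1 s *\<^sub>R D 0 s) /\<^sub>R 2)$l - (pole$j * r s$i - pole$i * r s$j) = 0" for s
      using that[of s] by simp
    ultimately have "((\<lambda>s. 2 * E s$l - (pole$j * X s$i - pole$i * X s$j)) has_real_derivative 0) (at s)" for s
      by (simp only:)
    from DERIV_isconst_all[OF allI[OF this], of L 0] show ?thesis
      by (simp add: EL M_def algebra_simps)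
  qed
  have c2: "pole$1 * M$3 - pole$3 * M$1 = 0"
  proof (rule cross[of 2])
    fix s show "(k s *\<^sub>R D 1 s - k1 s *\<^sub>R D 0 s)$2 = pole$1 * r s$3 - pole$3 * r s$1"
      using r_cross_T[of s] by (simp add: kk[of s] D_0) algebra
  qed
  have c3: "pole$2 * M$1 - pole$1 * M$2 = 0"
  proof (rule cross[of 3])
    fix s show "(k s *\<^sub>R D 1 s - k1 s *\<^sub>R D 0 s)$3 = pole$2 * r s$1 - pole$1 * r s$2"
      using r_cross_T[of s] by (simp add: kk[of s] D_0) algebra
  qed
  have "strict_mono (\<lambda>s. X s$1)"
    using nth_has_derivative[OF X] r_1_pos by (rule pos_deriv_strict_mono)
  from strict_monoD[OF this L_pos] have M1: "M$1 > 0" by (simp add: M_def)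
  \<comment> \<open>By \<open>c2\<close> and \<open>c3\<close>,
    \<open>M$1 *\<^sub>R pole = pole$1 *\<^sub>R M\<close>, so a zero of \<open>k\<close> at
    \<open>s\<close> makes \<open>r s\<close> orthogonal to \<open>M\<close>.\<close>
  have "M$1 * (r s \<bullet>\<^sub>L pole) = pole$1 * (r s \<bullet>\<^sub>L M)"
    unfolding lorentz_inner_def using c2 c3 by algebra
  then have "pole$1 * (r s \<bullet>\<^sub>L M) = 0"
    using r_pole[of s] k0 by (simp add: D_0)
  moreover have "pole$1 \<noteq> 0"
  proof
    assume "pole$1 = 0"
    then have "pole = 0" using c2 c3 M1 by (simp add: vec_eq_iff forall_3)
    then have "k u = 0" for u using r_pole[of u] by (simp add: lorentz_simps)
    with nonconst show False by simp
  qed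
  ultimately have rM: "r s \<bullet>\<^sub>L M = 0" by simp
  have "((\<lambda>t. X (t + L) - X t) has_vector_derivative 0) (at t)" for t
    using has_vector_derivative_diff[OF has_vector_derivative_shift[OF X] X, of L t] by (simp add: r_period)
  from vector_derivative_zero_imp_const[OF this, of _ 0] have XL: "X (t + L) - X t = M" for t
    by (simp add: M_def)
  \<comment> \<open>\<open>g\<close> is nondecreasing because points of the cone have nonpositive
    products, and periodic because \<open>r s\<close> is orthogonal to \<open>M\<close>. Hence
    \<open>r s\<close> is orthogonal to the whole curve, against \<open>gram_02\<close>.\<close>
  define g where "g = (\<lambda>t. - (r s \<bullet>\<^sub>L X t))"
  have g_deriv: "(g has_real_derivative - (r s \<bullet>\<^sub>L r t)) (at t)" for t
    using DERIV_minus[OF lorentz_has_derivative[OF has_vector_derivative_const X], of "r s" t]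
    by (simp add: g_def lorentz_simps)
  have nonneg: "- (r s \<bullet>\<^sub>L r t) \<ge> 0" for t
    using r_1_pos[of s] r_1_pos[of t] by (simp add: r_lorentz_r)
  have g_per: "g (t + L) = g t" for t
  proof -
    have "X (t + L) = X t + M" using XL[of t] by (simp add: algebra_simps)
    then show ?thesis by (simp add: g_def lorentz.add_right rM)
  qed
  have z0: "D 0 s \<bullet>\<^sub>L D 0 t = 0" for t
    using periodic_mono_deriv_zero[OF g_deriv nonneg g_per L_pos, of t] by (simp add: D_0)
  have z1: "D 0 s \<bullet>\<^sub>L D 1 t = 0" for t
    using const_imp_deriv_zero[OF z0 lorentz_has_derivative[OF has_vector_derivative_const D_deriv]]
    by (simp add: lorentz_simps)
  have "D 0 s \<bullet>\<^sub>L D 2 t = 0" for t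
    using const_imp_deriv_zero[OF z1 lorentz_has_derivative[OF has_vector_derivative_const D_deriv]]
    by (simp add: lorentz_simps)
  with gram_02[of s] show False by simp
qed

section \<open>Constant curvature\<close>

text \<open>For \<open>c \<ge> 0\<close> the Euclidean product of \<open>r'\<close> and
  \<open>r''\<close> would be nondecreasing and periodic, hence constant. This forces
  \<open>r'' = 0\<close> at 0, against \<open>gram_02\<close>.\<close>

lemma constant_curvature_neg:
  assumes const: "\<And>s. k s = c"
  shows "c < 0"
proof (rule ccontr)
  assume c: "\<not> c < 0"
  have k1: "k1 s = 0" for s by (rule const_imp_deriv_zero[OF const k_deriv])
  have deriv: "((\<lambda>s. D 1 s \<bullet> D 2 s) has_real_derivative D 2 s \<bullet> D 2 s + 2 * c * (D 1 s \<bullet> D 1 s)) (at s)" for s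
    using bounded_bilinear.has_vector_derivative[OF bounded_bilinear_inner D_deriv[of 1] D_deriv[of 2], of s]
    by (simp add: has_real_derivative_iff_has_vector_derivative D_3 k1 const add.commute)
  have nonneg: "D 2 s \<bullet> D 2 s + 2 * c * (D 1 s \<bullet> D 1 s) \<ge> 0" for s
    using c by simp
  have "D 2 0 \<bullet> D 2 0 + 2 * c * (D 1 0 \<bullet> D 1 0) = 0"
    by (rule periodic_mono_deriv_zero[OF deriv nonneg _ L_pos]) (simp add: D_period)
  moreover have "2 * c * (D 1 0 \<bullet> D 1 0) \<ge> 0" using c by simp
  ultimately have "D 2 0 \<bullet> D 2 0 = 0"
    using inner_ge_zero[of "D 2 0"] by linarith
  then have "D 2 0 = 0" by simp
  with gram_02[of 0] show False by (simp add: lorentz_simps)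
qed

text \<open>The tangent and the scaled second derivative rotate with constant speed
  \<open>w\<close>, so the curve is an affine image of a circle with conjugate semi-diameters
  \<open>B\<close> and \<open>C\<close>.\<close>

lemma constant_curvature_ellipse:
  assumes const: "\<And>s. k s = c"
  shows "planar_ellipse r L"
proof -
  have c: "c < 0" by (rule constant_curvature_neg[OF const])
  have k1: "k1 s = 0" for s by (rule const_imp_deriv_zero[OF const k_deriv])
  define w where "w = sqrt (- 2 * c)"
  have w: "w > 0" "w\<^sup>2 = - 2 * c" using c by (auto simp: w_def)
  have w2: "w * w = - 2 * c" using w by (simp add: power2_eq_square)
  have D3: "D 3 s = - (w * w) *\<^sub>R D 1 s" for s
    by (simp add: D_3 k1 const w2)
  define N where "N = (\<lambda>s. D 2 s /\<^sub>R w)"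
  have dT: "(D 1 has_vector_derivative w *\<^sub>R N s) (at s)" for s
    using D_deriv[of 1 s] w by (simp add: N_def)
  have dN: "(N has_vector_derivative - w *\<^sub>R D 1 s) (at s)" for s
    using has_vector_derivative_scaleR[OF DERIV_const D_deriv[of 2], of "inverse w" s] w(1)
    by (simp add: N_def D3 flip: mult.assoc)
  have dw: "((\<lambda>s. w * s) has_real_derivative w) (at s)" for s
    using DERIV_cmult[OF DERIV_ident, of w] by simp
  note frame = rotating_frame[of "D 1" "\<lambda>_. w" N "\<lambda>s. w * s", OF dT dN dw]
  define z where "z = D 0 0 + N 0 /\<^sub>R w"
  have center: "D 0 s = z - N s /\<^sub>R w" for s
  proof -
    have "((\<lambda>s. D 0 s + N s /\<^sub>R w) has_vector_derivative 0) (at s)" for s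
      using has_vector_derivative_add[OF D_deriv[of 0] has_vector_derivative_scaleR[OF DERIV_const dN, of "inverse w"], of s] w(1)
      by simp
    from vector_derivative_zero_imp_const[OF this, of s 0] show ?thesis
      by (simp add: z_def eq_diff_eq)
  qed
  define B where "B = - N 0 /\<^sub>R w"
  define C where "C = D 1 0 /\<^sub>R w"
  have r_eq: "r s = z + cos (w * s) *\<^sub>R B + sin (w * s) *\<^sub>R C" for s
  proof -
    have "r s = z - (cos (w * s) *\<^sub>R N 0 - sin (w * s) *\<^sub>R D 1 0) /\<^sub>R w"
      using center[of s] frame(2)[of s 0] by (simp add: D_0)
    then show ?thesis by (simp add: B_def C_def algebra_simps)
  qed
  have NN: "N s \<bullet>\<^sub>L N s = 1" for s
    using w2 c by (simp add: N_def lorentz_simps gram const field_simps)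
  have TN: "D 1 s \<bullet>\<^sub>L N s = 0" for s
    by (simp add: N_def lorentz_simps gram)
  have BC: "B \<bullet>\<^sub>L B = 1 / w\<^sup>2" "C \<bullet>\<^sub>L C = 1 / w\<^sup>2" "B \<bullet>\<^sub>L C = 0"
    using TN[of 0] by (simp_all add: B_def C_def lorentz_simps NN gram power2_eq_square field_simps lorentz_commute[of "N 0"])
  \<comment> \<open>Chords have the Lorentz length of chords of a circle of radius
    \<open>1 / w\<close>, so coinciding points differ by full turns.\<close>
  have dist: "(r s - r t) \<bullet>\<^sub>L (r s - r t) = 2 * (1 - cos (w * s - w * t)) / w\<^sup>2" for s t
  proof -
    have "r s - r t = (cos (w * s) - cos (w * t)) *\<^sub>R B + (sin (w * s) - sin (w * t)) *\<^sub>R C"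
      by (simp add: r_eq algebra_simps)
    then have "(r s - r t) \<bullet>\<^sub>L (r s - r t)
        = ((cos (w * s) - cos (w * t))\<^sup>2 + (sin (w * s) - sin (w * t))\<^sup>2) / w\<^sup>2"
      by (simp only:) (simp add: lorentz_simps BC lorentz_commute[of C B] power2_eq_square add_divide_distrib)
    also have "(cos (w * s) - cos (w * t))\<^sup>2 + (sin (w * s) - sin (w * t))\<^sup>2
        = 2 * (1 - cos (w * s - w * t))"
      using sin_cos_squared_add[of "w * s"] sin_cos_squared_add[of "w * t"]
      unfolding cos_diff by algebra
    finally show ?thesis .
  qed
  have eq_imp: "\<exists>j::int. w * (s - t) = 2 * pi * j" if "r s = r t" for s t
  proof -
    have "cos (w * s - w * t) = 1"
      using dist[of s t] that w(1) by (simp add: lorentz_simps)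
    then show ?thesis by (simp add: cos_eq_1_iff_int right_diff_distrib)
  qed
  \<comment> \<open>One full turn closes the curve, so minimality bounds \<open>L\<close>; within
    less than a turn no point repeats.\<close>
  have "L \<le> 2 * pi / w"
    using w(1) by (intro L_minimal) (simp_all add: r_eq distrib_left)
  then have wL: "w * L \<le> 2 * pi" using w(1) by (simp add: field_simps)
  have inj: "inj_on r {0..<L}"
  proof (rule inj_onI)
    fix s t assume st: "s \<in> {0..<L}" "t \<in> {0..<L}" "r s = r t"
    then obtain j :: int where j: "w * (s - t) = 2 * pi * j" using eq_imp by blast
    have "w * \<bar>s - t\<bar> < w * L" using st w(1) by auto
    moreover have "\<bar>w * (s - t)\<bar> = w * \<bar>s - t\<bar>" using w(1) by (simp add: abs_mult)
    ultimately have "\<bar>w * (s - t)\<bar> < 2 * pi" using wL by linarith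
    then have "2 * pi * \<bar>real_of_int j\<bar> < 2 * pi * 1" unfolding j by (simp add: abs_mult)
    then have "\<bar>real_of_int j\<bar> < 1"
      by (rule mult_left_less_imp_less) simp
    then have "j = 0" by linarith
    with j w(1) show "s = t" by simp
  qed
  have "r ` {0..<L} = {z + cos \<phi> *\<^sub>R B + sin \<phi> *\<^sub>R C |\<phi>. True}"
  proof (intro set_eqI iffI)
    fix y assume "y \<in> {z + cos \<phi> *\<^sub>R B + sin \<phi> *\<^sub>R C |\<phi>. True}"
    then obtain \<phi> where "y = z + cos \<phi> *\<^sub>R B + sin \<phi> *\<^sub>R C" by blast
    then have y: "y = r (\<phi> / w)" using w(1) by (simp add: r_eq)
    obtain t where "0 \<le> t" "t < L" "r t = r (\<phi> / w)"
      using periodic_attained_in_period[of r, OF r_period L_pos] .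
    then show "y \<in> r ` {0..<L}" unfolding y by (intro image_eqI[of _ _ t]) auto
  qed (auto simp: r_eq)
  moreover have "ellipse {z + cos \<phi> *\<^sub>R B + sin \<phi> *\<^sub>R C |\<phi>. True}"
  proof (rule ellipse_conjugate_diameters)
    fix x y assume 0: "x *\<^sub>R B + y *\<^sub>R C = 0"
    have "(x *\<^sub>R B + y *\<^sub>R C) \<bullet>\<^sub>L B = x / w\<^sup>2" "(x *\<^sub>R B + y *\<^sub>R C) \<bullet>\<^sub>L C = y / w\<^sup>2"
      by (simp_all add: lorentz_simps BC lorentz_commute[of C B])
    then show "x = 0 \<and> y = 0" unfolding 0 using w(1) by (simp add: lorentz_simps)
  qed
  ultimately show ?thesis
    unfolding planar_ellipse_def bij_betw_def using inj by auto
qed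

section \<open>Non-constant curvature\<close>

text \<open>The extreme values \<open>x < y\<close> of \<open>k\<close> are critical values, hence
  roots of the cubic, and the third root is \<open>- (x + y)\<close>. Since \<open>k\<close> has no
  zero, it has one sign; if it were positive, the cubic would be nonpositive between
  \<open>x\<close> and \<open>y\<close>, forcing \<open>k1 = 0\<close>. Passing to
  \<open>- k\<close> gives \<open>\<alpha> = - y\<close> and \<open>\<beta> = - x\<close>.\<close>

lemma nonconstant_curvature_roots:
  assumes nonconst: "k s\<^sub>1 \<noteq> k s\<^sub>2"
  obtains \<alpha> \<beta> where "elliptic_oscillation (\<lambda>s. - k s) (\<lambda>s. - k1 s) \<alpha> \<beta>"
    and "pole \<bullet>\<^sub>L pole = - (\<alpha> * \<beta> * (\<alpha> + \<beta>))"
proof -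
  have cont: "continuous_on UNIV k"
    by (rule differentiable_imp_continuous_on_UNIV[OF k_deriv])
  obtain a b where a: "\<And>s. k a \<le> k s" and b: "\<And>s. k s \<le> k b"
    using periodic_attains_extrema[OF cont k_period L_pos] by blast
  have ka: "k1 a = 0"
    by (rule DERIV_local_min[OF k_deriv zero_less_one]) (simp add: a)
  have kb: "k1 b = 0"
    by (rule DERIV_local_max[OF k_deriv zero_less_one]) (simp add: b)
  have ab: "k a < k b"
    using a[of s\<^sub>1] a[of s\<^sub>2] b[of s\<^sub>1] b[of s\<^sub>2] nonconst by linarith
  define d where "d = pole \<bullet>\<^sub>L pole"
  define x where "x = k a"
  define y where "y = k b"
  have xy: "x < y" using ab by (simp add: x_def y_def)
  have "x^3 + c2 * x + d = 0" "y^3 + c2 * y + d = 0"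
    using k1_sq[of a] k1_sq[of b] ka kb by (simp_all add: d_def x_def y_def)
  then have "(y - x) * (y\<^sup>2 + x * y + x\<^sup>2 + c2) = 0" by algebra
  with xy have c2: "c2 = - (x\<^sup>2 + x * y + y\<^sup>2)" by simp
  with \<open>x^3 + c2 * x + d = 0\<close> have d: "d = x * y * (x + y)" by algebra
  have cubic: "(k1 s)\<^sup>2 = (k s - x) * (k s - y) * (k s + x + y)" for s
    using k1_sq[of s] c2 d unfolding d_def[symmetric] by algebra
  have "y < 0"
  proof (rule ccontr)
    assume "\<not> y < 0"
    have "x > 0"
    proof (rule ccontr)
      assume "\<not> x > 0"
      then have "k a \<le> 0" "0 \<le> k b" using \<open>\<not> y < 0\<close> by (auto simp: x_def y_def)
      moreover have "connected (range k)"
        by (rule connected_continuous_image[OF cont connected_UNIV])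
      ultimately have "0 \<in> range k"
        by (meson connectedD_interval rangeI)
      then show False using k_nonzero[OF nonconst] by auto
    qed
    have "k1 s = 0" for s
    proof -
      have "(k s - x) * (k s - y) \<le> 0"
        using a[of s] b[of s] by (intro mult_nonneg_nonpos) (auto simp: x_def y_def)
      moreover have "k s + x + y \<ge> 0" using \<open>x > 0\<close> xy a[of s] by (simp add: x_def)
      ultimately have "(k1 s)\<^sup>2 \<le> 0" unfolding cubic by (rule mult_nonpos_nonneg)
      then show ?thesis by simp
    qed
    then have "k s\<^sub>1 = k s\<^sub>2"
      using DERIV_isconst_all[of k s\<^sub>1 s\<^sub>2] k_deriv by metis
    with nonconst show False by simp
  qed
  have "elliptic_oscillation (\<lambda>s. - k s) (\<lambda>s. - k1 s) (- y) (- x)"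
  proof
    show "0 < - y" "- y < - x" using \<open>y < 0\<close> xy by auto
    show "- y \<le> - k s" for s using b by (simp add: y_def)
    show "((\<lambda>s. - k s) has_real_derivative - k1 s) (at s)" for s
      by (rule DERIV_minus[OF k_deriv])
    show "((\<lambda>s. - k1 s) has_real_derivative
        ((- y)\<^sup>2 + - y * - x + (- x)\<^sup>2 - 3 * (- k s)\<^sup>2) / 2) (at s)" for s
      by (rule DERIV_cong[OF DERIV_minus[OF k1_deriv]]) (simp add: k2_eq c2 field_simps)
    show "(- k1 s)\<^sup>2 = (- k s - - y) * (- x - - k s) * (- k s + - y + - x)" for s
      using cubic[of s] by (simp add: algebra_simps)
  qed
  moreover have "pole \<bullet>\<^sub>L pole = - (- y * - x * (- y + - x))"
    using d by (simp add: d_def algebra_simps)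
  ultimately show thesis by (rule that)
qed

lemma nonconstant_curvature:
  assumes nonconst: "k s\<^sub>1 \<noteq> k s\<^sub>2"
  shows "\<exists>(p::nat) (q::nat) P. p > 0 \<and> q > 0 \<and> coprime p q \<and>
       rotation_index r L = real p \<and>
       minimal_period (geodesic_curvature r) P \<and> L = real q * P \<and>
       real p / real q \<in> {sqrt (2/3)<..<1}"
proof -
  obtain \<alpha> \<beta> where osc: "elliptic_oscillation (\<lambda>s. - k s) (\<lambda>s. - k1 s) \<alpha> \<beta>"
    and pole: "pole \<bullet>\<^sub>L pole = - (\<alpha> * \<beta> * (\<alpha> + \<beta>))"
    using nonconstant_curvature_roots[OF nonconst] .
  interpret osc: elliptic_oscillation "\<lambda>s. - k s" "\<lambda>s. - k1 s" \<alpha> \<beta> by (rule osc)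
  define P where "P = osc.period"
  have P_pos: "P > 0" by (simp add: P_def osc.period_pos)
  have k_neg: "k s < 0" for s using osc.\<kappa>_ge[of s] osc.\<alpha>_pos by simp
  define W where "W = sqrt (\<alpha> * \<beta> * (\<alpha> + \<beta>))"
  have W: "W > 0" "W * W = \<alpha> * \<beta> * (\<alpha> + \<beta>)"
    using osc.\<alpha>_pos osc.\<alpha>_less_\<beta> by (auto simp: W_def)
  have pole_W: "pole \<bullet>\<^sub>L pole = - (W * W)" using pole W(2) by simp

  have "continuous_on UNIV (\<lambda>s. W / - k s)"
    using k_neg by (intro continuous_intros differentiable_imp_continuous_on_UNIV[OF k_deriv])
      (auto simp: less_imp_neq)
  then obtain \<phi> where \<phi>: "\<And>s. (\<phi> has_real_derivative W / - k s) (at s)"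
    using real_antiderivative_exists_UNIV by blast
  have \<phi>_mono: "strict_mono \<phi>"
    using \<phi> by (rule pos_deriv_strict_mono) (use W k_neg in \<open>simp add: divide_pos_neg\<close>)
  have \<phi>_cont: "continuous_on UNIV \<phi>"
    by (rule differentiable_imp_continuous_on_UNIV[OF \<phi>])

  \<comment> \<open>\<open>u\<close> is the part of \<open>r / (- k)\<close> orthogonal to the
    time-like pole, and \<open>v\<close> is its derivative divided by the angular speed. Both rotate
    in the space-like plane orthogonal to the pole.\<close>
  define u where "u = (\<lambda>s. (- 1 / k s) *\<^sub>R D 0 s - (1 / (W * W)) *\<^sub>R pole)"
  define v where "v = (\<lambda>s. (1 / W) *\<^sub>R D 1 s - (k1 s / (W * k s)) *\<^sub>R D 0 s)"
  have du: "(u has_vector_derivative (W / - k s) *\<^sub>R v s) (at s)" for s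
  proof -
    have "((\<lambda>s. - 1 / k s) has_real_derivative k1 s / (k s * k s)) (at s)"
      using DERIV_divide[OF DERIV_const k_deriv, of s "- 1"] k_neg[of s] by simp
    from has_vector_derivative_diff[OF kD_deriv[OF this, of 0] has_vector_derivative_const, of "(1 / (W * W)) *\<^sub>R pole"]
    have "(u has_vector_derivative
        (k1 s / (k s * k s)) *\<^sub>R D 0 s + (- 1 / k s) *\<^sub>R D 1 s) (at s)"
      by (simp add: u_def)
    also have "(k1 s / (k s * k s)) *\<^sub>R D 0 s + (- 1 / k s) *\<^sub>R D 1 s = (W / - k s) *\<^sub>R v s"
      using W(1) k_neg[of s] by (simp add: v_def vec_eq_iff field_simps)
    finally show ?thesis .
  qed
  have dv: "(v has_vector_derivative - (W / - k s) *\<^sub>R u s) (at s)" for s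
  proof -
    have "((\<lambda>s. k1 s / (W * k s)) has_real_derivative
        (k2 s * (W * k s) - k1 s * (W * k1 s)) / ((W * k s) * (W * k s))) (at s)"
      by (intro DERIV_divide k1_deriv DERIV_cmult k_deriv) (use W(1) k_neg[of s] in auto)
    from has_vector_derivative_diff[OF kD_deriv[OF DERIV_const, of "1 / W" 1] kD_deriv[OF this, of 0]]
    have "(v has_vector_derivative (1 / W) *\<^sub>R D 2 s
        - (((k2 s * (W * k s) - k1 s * (W * k1 s)) / ((W * k s) * (W * k s))) *\<^sub>R D 0 s
        + (k1 s / (W * k s)) *\<^sub>R D 1 s)) (at s)"
      by (simp add: v_def)
    also have "(1 / W) *\<^sub>R D 2 s
        - (((k2 s * (W * k s) - k1 s * (W * k1 s)) / ((W * k s) * (W * k s))) *\<^sub>R D 0 s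
        + (k1 s / (W * k s)) *\<^sub>R D 1 s) = - (W / - k s) *\<^sub>R u s"
    proof -
      have WW: "W * W = 2 * k s * k2 s - 2 * (k s)^3 - (k1 s)\<^sup>2"
        using pole_pole[of s] pole_W by simp
      have nz: "W \<noteq> 0" "k s \<noteq> 0" using W(1) k_neg[of s] by auto
      have "(k2 s * (W * k s) - k1 s * (W * k1 s)) / ((W * k s) * (W * k s))
          = (W * (k s * W) + (2 * (k s)\<^sup>2 - k2 s) * (k s * k s)) / ((k s * k s) * (k s * W))"
        using nz WW by (subst frac_eq_eq) (simp, simp, algebra)
      also have "\<dots> = W / (k s * k s) + (2 * (k s)\<^sup>2 - k2 s) / (k s * W)"
        using nz by (subst add_frac_eq) simp_all
      finally have coeff: "(k2 s * (W * k s) - k1 s * (W * k1 s)) / ((W * k s) * (W * k s))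
          = W / (k s * k s) + (2 * (k s)\<^sup>2 - k2 s) / (k s * W)" .
      have "- (W / - k s) *\<^sub>R u s = - (W / (k s * k s)) *\<^sub>R D 0 s - (1 / (k s * W)) *\<^sub>R pole"
        using nz by (simp add: u_def scaleR_right_diff_distrib)
      also have "(1 / (k s * W)) *\<^sub>R pole = ((2 * (k s)\<^sup>2 - k2 s) / (k s * W)) *\<^sub>R D 0 s
          + (k1 s / (W * k s)) *\<^sub>R D 1 s - (1 / W) *\<^sub>R D 2 s"
        using nz by (subst pole_eq[of s])
          (simp add: scaleR_right_diff_distrib scaleR_right_distrib mult.commute)
      finally show ?thesis unfolding coeff by (simp add: algebra_simps)
    qed
    finally show ?thesis .
  qed
  have pole_gram: "pole \<bullet>\<^sub>L D 0 s = k s" "pole \<bullet>\<^sub>L D 1 s = k1 s" for s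
    using r_pole[of s] T_pole[of s] by (simp_all add: lorentz_commute)
  have uu: "u s \<bullet>\<^sub>L u s = 1 / (W * W)" and uv: "v s \<bullet>\<^sub>L u s = 0"
    and up: "u s \<bullet>\<^sub>L pole = 0" for s
    using W(1) k_neg[of s]
    by (simp_all add: u_def v_def lorentz_simps gram r_pole T_pole pole_gram pole_W field_simps)
  note rot = rotating_frame[OF du dv \<phi>]
  have u_eq: "r s = (- k s) *\<^sub>R (u s + (1 / (W * W)) *\<^sub>R pole)" for s
    using k_neg[of s] by (simp add: u_def D_0)
  have rr: "r s \<bullet>\<^sub>L r t = - (k s * k t * (1 - cos (\<phi> s - \<phi> t))) / (W * W)" for s t
  proof -
    have "u s \<bullet>\<^sub>L u t = cos (\<phi> s - \<phi> t) / (W * W)"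
      by (subst rot(1)[of s t]) (simp add: lorentz_simps uu uv)
    then show ?thesis
      using W(1) by (subst (1 2) u_eq)
        (simp add: lorentz_simps up lorentz_commute[of pole "u _"] pole_W field_simps)
  qed
  \<comment> \<open>Both angles express when \<open>r s\<close> and \<open>r 0\<close> lie on the
    same null ray, so they have the same returns.\<close>
  have null_iff: "cos (\<phi> s - \<phi> 0) = 1 \<longleftrightarrow> cos (\<theta> s - \<theta> 0) = 1" for s
  proof -
    have "cos (\<phi> s - \<phi> 0) = 1 \<longleftrightarrow> r s \<bullet>\<^sub>L r 0 = 0"
      using k_neg[of s] k_neg[of 0] W(1) by (auto simp: rr)
    also have "\<dots> \<longleftrightarrow> cos (\<theta> s - \<theta> 0) = 1"
      using r_1_pos[of s] r_1_pos[of 0] by (auto simp: r_lorentz_r)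
    finally show ?thesis .
  qed
  have \<theta>_mono: "strict_mono \<theta>"
    using \<theta>_deriv by (rule pos_deriv_strict_mono) (simp add: r_1_pos)
  have \<theta>_cont: "continuous_on UNIV \<theta>"
    by (rule differentiable_imp_continuous_on_UNIV[OF \<theta>_deriv])
  have turns: "\<exists>p>0. \<psi> L - \<psi> 0 = 2 * pi * real p"
    if "strict_mono \<psi>" "cos (\<psi> L - \<psi> 0) = 1" for \<psi> :: "real \<Rightarrow> real"
  proof -
    obtain j :: int where j: "\<psi> L - \<psi> 0 = 2 * pi * j"
      using \<open>cos (\<psi> L - \<psi> 0) = 1\<close> by (auto simp: cos_eq_1_iff_int)
    have "\<psi> L > \<psi> 0" using \<open>strict_mono \<psi>\<close> L_pos by (simp add: strict_mono_less)
    then have "0 < 2 * pi * real_of_int j" using j by linarith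
    then have "j > 0" using pi_gt_zero by (simp add: zero_less_mult_iff)
    then show ?thesis using j by (intro exI[of _ "nat j"]) simp
  qed
  have "r L \<bullet>\<^sub>L r 0 = 0"
    using r_period[of 0] gram_00[of 0] by (simp add: D_0)
  then have cos_\<theta>: "cos (\<theta> L - \<theta> 0) = 1"
    using r_1_pos[of L] r_1_pos[of 0] by (simp add: r_lorentz_r)
  then have cos_\<phi>: "cos (\<phi> L - \<phi> 0) = 1" by (simp add: null_iff)
  obtain p where p: "p > 0" "\<phi> L - \<phi> 0 = 2 * pi * real p"
    using turns[OF \<phi>_mono cos_\<phi>] by blast
  obtain p' where p': "p' > 0" "\<theta> L - \<theta> 0 = 2 * pi * real p'"
    using turns[OF \<theta>_mono cos_\<theta>] by blast
  have "p' = p"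
    using card_full_turns[OF \<theta>_mono \<theta>_cont L_pos p'(2)] card_full_turns[OF \<phi>_mono \<phi>_cont L_pos p(2)]
    by (simp add: null_iff)
  have rot_index: "rotation_index r L = real p"
  proof -
    \<comment> \<open>The angle function picked by \<open>rotation_index\<close> may differ from
      \<open>\<theta>\<close>, but only by a constant.\<close>
    define \<psi> where "\<psi> = (SOME \<theta>. angle_function r \<theta>)"
    have "angle_function r \<psi>" unfolding \<psi>_def by (rule someI[of _ \<theta>]) (rule angle)
    from angle_functions_differ_by_const[OF this angle r_1_pos, of L 0]
    have "\<psi> L - \<psi> 0 = 2 * pi * real p" using p'(2) \<open>p' = p\<close> by simp
    then show ?thesis by (simp add: rotation_index_def flip: \<psi>_def)
  qed

  obtain q where q: "q > 0" "L = real q * P"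
    using osc.period_multiple[OF L_pos] k_period unfolding P_def by auto
  have k_P: "k (s + P) = k s" for s
    using osc.\<kappa>_period[of s] by (simp add: P_def)
  define \<Theta> where "\<Theta> = \<phi> (0 + P) - \<phi> 0"
  have \<phi>_P: "\<phi> (s + P) = \<phi> s + \<Theta>" for s
  proof -
    have "((\<lambda>s. \<phi> (s + P)) has_real_derivative W / - k (s + P)) (at s)" for s
      by (rule DERIV_shift[THEN iffD1, OF \<phi>])
    from DERIV_diff[OF this \<phi>] have "((\<lambda>s. \<phi> (s + P) - \<phi> s) has_real_derivative 0) (at s)" for s
      by (simp only: k_P diff_self)
    from DERIV_isconst_all[OF allI[OF this], of s 0] show ?thesis
      unfolding \<Theta>_def by linarith
  qed
  have \<phi>_nP: "\<phi> (s + real n * P) = \<phi> s + real n * \<Theta>" for s n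
  proof (induction n)
    case (Suc n)
    have "\<phi> (s + real (Suc n) * P) = \<phi> (s + real n * P + P)"
      by (simp add: algebra_simps)
    then show ?case by (simp only: \<phi>_P Suc) (simp add: algebra_simps)
  qed simp
  have k_nP: "k (s + real n * P) = k s" for s n
  proof (induction n)
    case (Suc n)
    have "k (s + real (Suc n) * P) = k (s + real n * P + P)"
      by (simp add: algebra_simps)
    then show ?case by (simp only: k_P Suc)
  qed simp
  have q\<Theta>: "real q * \<Theta> = 2 * pi * real p"
    using \<phi>_nP[of 0 q] p(2) q(2) by simp
  have "coprime p q"
  proof (rule ccontr)
    assume "\<not> coprime p q"
    define g where "g = gcd p q"
    have "g > 1"
      using \<open>\<not> coprime p q\<close> p(1) unfolding g_def coprime_iff_gcd_eq_1
      by (metis gcd_nat.eq_neutr_iff gr_zeroI less_one nat_neq_iff)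
    obtain p1 q1 where pq: "p = g * p1" "q = g * q1"
      unfolding g_def by (meson dvdE gcd_dvd1 gcd_dvd2)
    have "real g * (real q1 * \<Theta>) = real g * (2 * pi * real p1)"
      using q\<Theta> by (simp add: pq mult_ac)
    then have q1: "real q1 * \<Theta> = 2 * pi * real p1"
      using \<open>g > 1\<close> by simp
    \<comment> \<open>After \<open>q1\<close> periods the curvature repeats and the angle has made
      \<open>p1\<close> full turns, so the curve would already close there, against the minimality
      of \<open>L\<close>.\<close>
    have "r (s + real q1 * P) = r s" for s
    proof -
      have "u (s + real q1 * P) = u s"
        using rot(1)[of "s + real q1 * P" s] by (simp add: \<phi>_nP q1 cos_sin_turns)
      then show ?thesis by (subst (1 2) u_eq) (simp add: k_nP)
    qed
    moreover have "q1 > 0" using q(1) pq by simp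
    ultimately have "L \<le> real q1 * P" using P_pos by (intro L_minimal) auto
    moreover have "real q1 < real q" using \<open>g > 1\<close> \<open>q1 > 0\<close> pq by simp
    ultimately show False using P_pos q(2) by simp
  qed
  moreover have "minimal_period (geodesic_curvature r) P"
    using osc.minimal_period_\<kappa> by (simp add: geodesic_curvature_eq[abs_def] minimal_period_def P_def)
  moreover have "real p / real q \<in> {sqrt (2/3)<..<1}"
  proof -
    have "\<Theta> < 2 * pi" "2 * pi * sqrt (2/3) < \<Theta>"
      using osc.angle_per_period[of \<phi> 0] \<phi> unfolding \<Theta>_def P_def W_def by auto
    moreover have "\<Theta> = 2 * pi * (real p / real q)"
      using q\<Theta> q(1) by (simp add: field_simps)
    moreover have pos: "0 < 2 * pi" by simp
    ultimately have "2 * pi * sqrt (2/3) < 2 * pi * (real p / real q)"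
      "2 * pi * (real p / real q) < 2 * pi * 1" by simp_all
    then have "sqrt (2/3) < real p / real q" "real p / real q < 1"
      unfolding mult_less_cancel_left_pos[OF pos] .
    then show ?thesis by simp
  qed
  ultimately show ?thesis
    using p(1) q rot_index by blast
qed

end

theorem theorem1p3:
  fixes x :: "real \<Rightarrow> real^3" and L :: real
  assumes "soliton x" and "closed_curve x L"
  shows "planar_ellipse x L \<or>
    (\<exists>(p::nat) (q::nat) P. p > 0 \<and> q > 0 \<and> coprime p q \<and>
       rotation_index x L = real p \<and>
       minimal_period (geodesic_curvature x) P \<and> L = real q * P \<and>
       real p / real q \<in> {sqrt (2/3)<..<1})"
proof -
  interpret closed_soliton x L
    using assms by unfold_locales (auto simp: soliton_def)
  show ?thesis
  proof (cases "\<exists>s t. k s \<noteq> k t")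
    case True
    then show ?thesis using nonconstant_curvature by blast
  next
    case False
    then show ?thesis using constant_curvature_ellipse[of "k 0"] by blast
  qed
qed

end
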